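(* Let $U,n_t$ be positive integers and let $C_{U,n_t}\in\mathfrak{C}_{U,n_t}$. The code $C_{U,n_t}$ is a full rate code and satisfies the generalized rank criterion.
   Context: All fields are subfields of $\mathbb{C}$, and $\mathcal{O}_E$ denotes the ring of integers of a number field $E$. Suitable data: $K$ is an imaginary quadratic extension of $\mathbb{Q}$ with class number $1$; $L/K$ is a cyclic Galois extension of degree $Un_t$ such that $L=K(\alpha)$ for some $\alpha\in\mathbb{R}$; $\sigma$ is a generator of $\mathrm{Gal}(L/K)$; $p\in\mathcal{O}_K$ is a prime that is inert in $L/K$ (i.e. $p\mathcal{O}_K$ is a nonzero prime ideal and $p\mathcal{O}_L$ is again prime). Put $\tau=\sigma^U$. For $x_1,\dots,x_{n_t}\in\mathcal{O}_L$ let $M(x_1,\dots,x_{n_t})$ be the $n_t\times n_t$ matrix whose $(i,j)$ entry is $\tau^{j-1}(x_{i-j+1})$ if $i\ge j$ and $p\,\tau^{j-1}(x_{i-j+1+n_t})$ if $i<j$. Automorphisms are applied to matrices entrywise. Let $k$ be an integer with $k>\frac{U(n_t-1)}{2}$. For $j=1,\dots,U$, the code $\mathcal{C}_j$ of the $j$th user is the set of $n_t\times Un_t$ matrices $$B_j=\left(M_j,\ \sigma(M_j),\ \dots,\ p^{-k}\sigma^{j-1}(M_j),\ \dots,\ \sigma^{U-1}(M_j)\right)$$ (the $l$th block is $\sigma^{l-1}(M_j)$, with the extra factor $p^{-k}$ exactly when $l=j$), where $M_j=M(x_{j,1},\dots,x_{j,n_t})$, $x_{j,h}\in\mathcal{O}_L$,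 and $x_{j,h}\ne0$ for some $h$. The code $C_{U,n_t}(L/K,p,\sigma,k)$ is the set of all $Un_t\times Un_t$ matrices $A$ obtained by stacking $B_1,\dots,B_U$ vertically with $B_j\in\mathcal{C}_j$. $\mathfrak{C}_{U,n_t}$ is the family of all codes $C_{U,n_t}(L/K,p,\sigma,k)$ obtained from any suitable $(K,L,p,\sigma)$ and any integer $k>\frac{U(n_t-1)}{2}$. Let $\mathbf{L}_j=\mathcal{C}_j\cup\{0\}$. Full rate means that each $\mathbf{L}_j$ is a lattice (discrete additive subgroup) in $M_{n_t\times Un_t}(\mathbb{C})$ of full rank $r=2Un_t^2$ over $\mathbb{Z}$. Fix a $\mathbb{Z}$-basis $B_{j,1},\dots,B_{j,r}$ of each $\mathbf{L}_j$, and for a positive integer $N_j$ let $\mathbf{L}_j(N_j)=\{\sum_{i=1}^r b_iB_{j,i}: b_i\in\mathbb{Z},\ -N_j\le b_i\le N_j\}$. The decay function is $$D(N_1,\dots,N_U)=\min_{X_j\in\mathbf{L}_j(N_j)\setminus\{0\},\ j=1,\dots,U}\left|\det\left(X_1^T,X_2^T,\dots,X_U^T\right)^T\right|.$$ The code satisfies the (generalized) rank criterion if $D(N_1,\dots,N_U)\neq0$ for all positive integers $N_1,\dots,N_U$ (equivalently, $\det A\ne0$ for every $A\in C_{U,n_t}$). *)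

theory Defs
  imports
    Complex_Main
    "HOL-Computational_Algebra.Polynomial"
    "HOL-Algebra.Algebra"
    "HOL-Algebra.Algebraic_Closure_Type"
    "Jordan_Normal_Form.Matrix"
    "Jordan_Normal_Form.Determinant"
begin

section \<open>Subfields of the complex numbers\<close>

abbreviation complex_ring :: "complex ring" where
  "complex_ring \<equiv> ring_of_type_algebra"

definition field_extension_of_degree :: "nat \<Rightarrow> complex set \<Rightarrow> complex set \<Rightarrow> bool" where
  "field_extension_of_degree n K L \<longleftrightarrow>
     subfield K complex_ring \<and> subfield L complex_ring \<and> K \<subseteq> L \<and>
     ring.dimension complex_ring n K L"

definition ring_of_integers :: "complex set \<Rightarrow> complex ring" where
  "ring_of_integers E = complex_ring\<lparr>carrier := {x \<in> E. algebraic_int x}\<rparr>"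

text \<open>The ideal class group of a domain, as a set: nonzero integral ideals \<open>I\<close>, \<open>J\<close> are
  equivalent iff \<open>a I = b J\<close> for some nonzero ring elements \<open>a\<close>, \<open>b\<close>.\<close>

definition nonzero_ideals :: "complex ring \<Rightarrow> complex set set" where
  "nonzero_ideals R = {I. ideal I R \<and> I \<noteq> {\<zero>\<^bsub>R\<^esub>}}"

definition ideal_class_rel :: "complex ring \<Rightarrow> (complex set \<times> complex set) set" where
  "ideal_class_rel R =
     {(I, J). I \<in> nonzero_ideals R \<and> J \<in> nonzero_ideals R \<and>
        (\<exists>a \<in> carrier R - {\<zero>\<^bsub>R\<^esub>}. \<exists>b \<in> carrier R - {\<zero>\<^bsub>R\<^esub>}. a <#\<^bsub>R\<^esub> I = b <#\<^bsub>R\<^esub> J)}"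

definition class_number :: "complex set \<Rightarrow> nat" where
  "class_number K =
     card (nonzero_ideals (ring_of_integers K) // ideal_class_rel (ring_of_integers K))"

definition imaginary_quadratic :: "complex set \<Rightarrow> bool" where
  "imaginary_quadratic K \<longleftrightarrow> field_extension_of_degree 2 \<rat> K \<and> \<not> K \<subseteq> \<real>"

text \<open>Automorphisms of \<open>L\<close> are represented by functions that are \<open>undefined\<close> outside \<open>L\<close>.\<close>

definition galois_group :: "complex set \<Rightarrow> complex set \<Rightarrow> (complex \<Rightarrow> complex) monoid" where
  "galois_group L K =
     (BijGroup L)\<lparr>carrier :=
        {f \<in> Bij L. f \<in> ring_iso (complex_ring\<lparr>carrier := L\<rparr>) (complex_ring\<lparr>carrier := L\<rparr>) \<and>
                    (\<forall>x\<in>K. f x = x)}\<rparr>"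

definition galois_extension_of_degree :: "nat \<Rightarrow> complex set \<Rightarrow> complex set \<Rightarrow> bool" where
  "galois_extension_of_degree n K L \<longleftrightarrow>
     field_extension_of_degree n K L \<and>
     {x \<in> L. \<forall>f \<in> carrier (galois_group L K). f x = x} = K"

definition inert :: "complex set \<Rightarrow> complex set \<Rightarrow> complex \<Rightarrow> bool" where
  "inert K L p \<longleftrightarrow>
     p \<in> carrier (ring_of_integers K) \<and> p \<noteq> 0 \<and>
     primeideal (PIdl\<^bsub>ring_of_integers K\<^esub> p) (ring_of_integers K) \<and>
     primeideal (PIdl\<^bsub>ring_of_integers L\<^esub> p) (ring_of_integers L)"

definition suitable ::
  "nat \<Rightarrow> nat \<Rightarrow> complex set \<Rightarrow> complex set \<Rightarrow> complex \<Rightarrow> (complex \<Rightarrow> complex) \<Rightarrow> bool" where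
  "suitable U nt K L p \<sigma> \<longleftrightarrow>
     imaginary_quadratic K \<and> class_number K = 1 \<and>
     galois_extension_of_degree (U * nt) K L \<and>
     \<sigma> \<in> carrier (galois_group L K) \<and>
     generate (galois_group L K) {\<sigma>} = carrier (galois_group L K) \<and>
     (\<exists>\<alpha>\<in>\<real>. L = generate_field complex_ring (insert \<alpha> K)) \<and>
     inert K L p"


section \<open>The codes\<close>

text \<open>Rows, columns, users and blocks are numbered from \<open>0\<close>; accordingly \<open>x h\<close> for \<open>h < nt\<close>
  is the element usually written with index \<open>h + 1\<close>.\<close>

definition cyclic_matrix ::
  "nat \<Rightarrow> complex \<Rightarrow> (complex \<Rightarrow> complex) \<Rightarrow> (nat \<Rightarrow> complex) \<Rightarrow> complex mat" where
  "cyclic_matrix nt p \<tau> x =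
     mat nt nt (\<lambda>(i, j). if i \<ge> j then (\<tau> ^^ j) (x (i - j))
                         else p * (\<tau> ^^ j) (x (i + nt - j)))"

definition user_matrix ::
  "nat \<Rightarrow> nat \<Rightarrow> complex \<Rightarrow> (complex \<Rightarrow> complex) \<Rightarrow> int \<Rightarrow> nat \<Rightarrow> (nat \<Rightarrow> complex) \<Rightarrow> complex mat" where
  "user_matrix U nt p \<sigma> k j x =
     mat nt (U * nt) (\<lambda>(i, c).
       let l = c div nt; M = cyclic_matrix nt p (\<sigma> ^^ U) x
       in (if l = j then p powi (- k) else 1) * map_mat (\<sigma> ^^ l) M $$ (i, c mod nt))"

definition user_code ::
  "nat \<Rightarrow> nat \<Rightarrow> complex set \<Rightarrow> complex \<Rightarrow> (complex \<Rightarrow> complex) \<Rightarrow> int \<Rightarrow> nat \<Rightarrow> complex mat set" where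
  "user_code U nt L p \<sigma> k j =
     {user_matrix U nt p \<sigma> k j x | x.
        (\<forall>h<nt. x h \<in> carrier (ring_of_integers L)) \<and> (\<exists>h<nt. x h \<noteq> 0)}"

definition stack :: "nat \<Rightarrow> nat \<Rightarrow> (nat \<Rightarrow> complex mat) \<Rightarrow> complex mat" where
  "stack U nt Z = mat (U * nt) (U * nt) (\<lambda>(i, c). Z (i div nt) $$ (i mod nt, c))"

definition stacked_code :: "nat \<Rightarrow> nat \<Rightarrow> (nat \<Rightarrow> complex mat set) \<Rightarrow> complex mat set" where
  "stacked_code U nt C = {stack U nt Z | Z. \<forall>j<U. Z j \<in> C j}"

text \<open>A multiuser code is given by its family of user codes \<open>C j\<close> (\<open>j < U\<close>); the corresponding
  set of square matrices is \<open>stacked_code U nt C\<close>. As the user codes are nonempty, this set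
  determines them: \<open>C j\<close> consists of the \<open>j\<close>-th row blocks of its elements.\<close>

definition code_family :: "nat \<Rightarrow> nat \<Rightarrow> (nat \<Rightarrow> complex mat set) set" where
  "code_family U nt =
     {user_code U nt L p \<sigma> k | K L p \<sigma> k.
        suitable U nt K L p \<sigma> \<and> of_int k > real U * (real nt - 1) / 2}"


section \<open>Lattices of matrices and full rate\<close>

definition int_combination ::
  "nat \<Rightarrow> nat \<Rightarrow> nat \<Rightarrow> (nat \<Rightarrow> complex mat) \<Rightarrow> (nat \<Rightarrow> int) \<Rightarrow> complex mat" where
  "int_combination nr nc r B b =
     mat nr nc (\<lambda>(i, c). \<Sum>m<r. of_int (b m) * B m $$ (i, c))"

definition int_basis ::
  "nat \<Rightarrow> nat \<Rightarrow> nat \<Rightarrow> (nat \<Rightarrow> complex mat) \<Rightarrow> complex mat set \<Rightarrow> bool" where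
  "int_basis nr nc r B \<Lambda> \<longleftrightarrow>
     (\<forall>m<r. B m \<in> \<Lambda>) \<and>
     bij_betw (int_combination nr nc r B) ({..<r} \<rightarrow>\<^sub>E UNIV) \<Lambda>"

definition discrete_matrices :: "nat \<Rightarrow> nat \<Rightarrow> complex mat set \<Rightarrow> bool" where
  "discrete_matrices nr nc \<Lambda> \<longleftrightarrow>
     (\<forall>A\<in>\<Lambda>. \<exists>\<epsilon>>0. \<forall>B\<in>\<Lambda>.
        (\<forall>i<nr. \<forall>c<nc. cmod (A $$ (i, c) - B $$ (i, c)) < \<epsilon>) \<longrightarrow> B = A)"

definition matrix_lattice :: "nat \<Rightarrow> nat \<Rightarrow> nat \<Rightarrow> complex mat set \<Rightarrow> bool" where
  "matrix_lattice nr nc r \<Lambda> \<longleftrightarrow>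
     additive_subgroup \<Lambda> (module_mat TYPE(complex) nr nc) \<and>
     discrete_matrices nr nc \<Lambda> \<and>
     (\<exists>B. int_basis nr nc r B \<Lambda>)"

definition user_lattice :: "nat \<Rightarrow> nat \<Rightarrow> (nat \<Rightarrow> complex mat set) \<Rightarrow> nat \<Rightarrow> complex mat set" where
  "user_lattice U nt C j = C j \<union> {0\<^sub>m nt (U * nt)}"

definition full_rate :: "nat \<Rightarrow> nat \<Rightarrow> (nat \<Rightarrow> complex mat set) \<Rightarrow> bool" where
  "full_rate U nt C \<longleftrightarrow>
     (\<forall>j<U. matrix_lattice nt (U * nt) (2 * U * nt\<^sup>2) (user_lattice U nt C j))"


section \<open>The decay function and the generalized rank criterion\<close>

definition truncated_lattice ::
  "nat \<Rightarrow> nat \<Rightarrow> nat \<Rightarrow> (nat \<Rightarrow> complex mat) \<Rightarrow> nat \<Rightarrow> complex mat set" where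
  "truncated_lattice nr nc r B N =
     {int_combination nr nc r B b | b. \<forall>m<r. - int N \<le> b m \<and> b m \<le> int N}"

text \<open>For positive \<open>N j\<close> and bases \<open>B j\<close> of full rate user lattices, the minimum is over a finite
  nonempty set.\<close>

definition decay ::
  "nat \<Rightarrow> nat \<Rightarrow> (nat \<Rightarrow> nat \<Rightarrow> complex mat) \<Rightarrow> (nat \<Rightarrow> nat) \<Rightarrow> real" where
  "decay U nt B N =
     Min ((\<lambda>A. cmod (det A)) `
       stacked_code U nt
         (\<lambda>j. truncated_lattice nt (U * nt) (2 * U * nt\<^sup>2) (B j) (N j) - {0\<^sub>m nt (U * nt)}))"

definition generalized_rank_criterion ::
  "nat \<Rightarrow> nat \<Rightarrow> (nat \<Rightarrow> complex mat set) \<Rightarrow> bool" where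
  "generalized_rank_criterion U nt C \<longleftrightarrow>
     (\<forall>B N. (\<forall>j<U. int_basis nt (U * nt) (2 * U * nt\<^sup>2) (B j) (user_lattice U nt C j)) \<and>
            (\<forall>j<U. N j > 0) \<longrightarrow> decay U nt B N \<noteq> 0)"

end

theory Submission
  imports Defs "Jordan_Normal_Form.Char_Poly"
begin

text \<open>
  Everything is controlled by two facts about \<open>L\<close>. First, the relative norm of a nonzero integer of
  \<open>L\<close> is a nonzero integer of an imaginary quadratic field, so some conjugate has absolute value at
  least \<open>1\<close>. Since all conjugates of all coordinates occur, up to fixed scalars, as entries of a code
  matrix, the user lattices are discrete. The same bound makes sets of integers with bounded
  conjugates finite, which yields an integral basis and thus the full rank.

  Second, as \<open>p\<close> is inert, it defines a valuation of \<open>L\<close> that is invariant under \<open>\<sigma>\<close>. After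
  multiplication by \<open>p\<^sup>k\<close>, the weight \<open>n\<^sub>t v(entry) + a - b\<close> of the entry in row \<open>a\<close> and column \<open>b\<close> of
  a block is \<open>n\<^sub>t v(x\<^sub>h) + h\<close> on the diagonal blocks, with \<open>h = a - b mod n\<^sub>t\<close>, and larger by \<open>n\<^sub>t k\<close>
  elsewhere. These values are distinct modulo \<open>n\<^sub>t\<close> for distinct \<open>h\<close>, so each row block has a unique
  minimising \<open>h\<close>. Hence exactly one permutation in the Leibniz expansion attains the minimal valuation,
  and the determinant cannot vanish.
\<close>

section \<open>Algebraic integers form a ring\<close>

text \<open>With \<tau> = \<sigma>^U, the matrix M(x) is left multiplication by the sum of the u^h
  x_h in the cyclic algebra with y u = u \<tau>(y) and u^nt = p, written in the basis 1, u, ...,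
  u^(nt-1). So u acts like an nt-th root of p, of valuation 1/nt, and the weight nt v(x_h) + h is nt
  times the valuation of u^h x_h. This explains why different h cannot tie. The correction a - b is
  harmless in the Leibniz expansion: row and column indices run over the same set, so the
  corrections sum to zero along every permutation. Comparing permutations thus becomes an assignment
  problem, solved entry by entry. The factor p^k clears all denominators, so the valuation is only
  ever taken of nonzero integers of L and can be a natural number. The norm argument needs some
  power of \<sigma> that is the identity on L, with exponent at most U nt. It comes from counting
  roots at a generator of L over K; the product of that many conjugates is fixed by \<sigma> and
  hence lies in K.\<close>

definition int_span :: "'i set \<Rightarrow> ('i \<Rightarrow> complex) \<Rightarrow> complex set" where
  "int_span I v = {\<Sum>i\<in>I. of_int (c i) * v i | c :: 'i \<Rightarrow> int. True}"

lemma int_span_memI: "(\<Sum>i\<in>I. of_int (c i) * v i) \<in> int_span I v"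
  unfolding int_span_def by blast

lemma int_span_base:
  assumes "finite I" "i \<in> I"
  shows "v i \<in> int_span I v"
proof -
  have "(\<Sum>j\<in>I. of_int (if j = i then 1 else 0) * v j) = (\<Sum>j\<in>I. if j = i then v j else 0)"
    by (intro sum.cong) auto
  with assms have "v i = (\<Sum>j\<in>I. of_int (if j = i then 1 else 0) * v j)"
    by simp
  then show ?thesis
    using int_span_memI[of "\<lambda>j. if j = i then 1 else 0"] by metis
qed

lemma int_span_add:
  assumes "x \<in> int_span I v" "y \<in> int_span I v"
  shows "x + y \<in> int_span I v"
proof -
  obtain c d where "x = (\<Sum>i\<in>I. of_int (c i) * v i)" "y = (\<Sum>i\<in>I. of_int (d i) * v i)"
    using assms unfolding int_span_def by blast
  then have "x + y = (\<Sum>i\<in>I. of_int (c i + d i) * v i)"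
    by (simp add: algebra_simps sum.distrib)
  then show ?thesis
    using int_span_memI[of "\<lambda>i. c i + d i"] by metis
qed

lemma int_span_scale:
  assumes "x \<in> int_span I v"
  shows "of_int m * x \<in> int_span I v"
proof -
  obtain c where "x = (\<Sum>i\<in>I. of_int (c i) * v i)"
    using assms unfolding int_span_def by blast
  then have "of_int m * x = (\<Sum>i\<in>I. of_int (m * c i) * v i)"
    by (simp add: algebra_simps sum_distrib_left)
  then show ?thesis
    using int_span_memI[of "\<lambda>i. m * c i"] by metis
qed

lemma int_span_sum:
  assumes "\<And>j. j \<in> J \<Longrightarrow> f j \<in> int_span I v"
  shows "(\<Sum>j\<in>J. f j) \<in> int_span I v"
proof -
  have "0 \<in> int_span I v"
    using int_span_memI[of "\<lambda>_. 0" v I] by simp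
  with assms show ?thesis
    by (induction J rule: infinite_finite_induct) (auto intro: int_span_add)
qed

text \<open>For products of two numbers: in \<open>x * (y * v i)\<close> the second factor is only
  known to lie in the span.\<close>

lemma int_span_stableI:
  assumes "\<And>i. i \<in> I \<Longrightarrow> x * v i \<in> int_span I v" "h \<in> int_span I v"
  shows "x * h \<in> int_span I v"
proof -
  obtain c where "h = (\<Sum>i\<in>I. of_int (c i) * v i)"
    using assms unfolding int_span_def by blast
  then have "x * h = (\<Sum>i\<in>I. of_int (c i) * (x * v i))"
    by (simp add: algebra_simps sum_distrib_left)
  then show ?thesis
    using assms by (auto intro!: int_span_sum int_span_scale)
qed

text \<open>Determinant trick: \<open>x\<close> is an eigenvalue of an integer matrix, hence a root
  of its monic integer characteristic polynomial. The nonzero \<open>v i\<close> makes the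
  eigenvector nonzero.\<close>

lemma algebraic_int_if_int_span_stable:
  assumes "finite I" "i \<in> I" "v i \<noteq> 0"
    and stable: "\<And>i. i \<in> I \<Longrightarrow> x * v i \<in> int_span I v"
  shows "algebraic_int x"
proof -
  define n where "n = card I"
  obtain e where e: "bij_betw e {0..<n} I"
    using ex_bij_betw_nat_finite[OF \<open>finite I\<close>] unfolding n_def by blast
  have "\<exists>c. \<forall>i\<in>I. x * v i = (\<Sum>j\<in>I. of_int (c i j :: int) * v j)"
    using stable unfolding int_span_def mem_Collect_eq by metis
  then obtain c :: "_ \<Rightarrow> _ \<Rightarrow> int" where c: "\<And>i. i \<in> I \<Longrightarrow> x * v i = (\<Sum>j\<in>I. of_int (c i j) * v j)"
    by blast
  define A where "A = mat n n (\<lambda>(i, j). c (e i) (e j))"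
  define w where "w = vec n (\<lambda>i. v (e i))"
  have A: "A \<in> carrier_mat n n"
    by (simp add: A_def)
  have "map_mat of_int A *\<^sub>v w = x \<cdot>\<^sub>v w"
  proof (rule eq_vecI)
    fix i assume "i < dim_vec (x \<cdot>\<^sub>v w)"
    then have i: "i < n"
      by (simp add: w_def)
    then have "e i \<in> I"
      using e by (auto simp: bij_betw_def)
    have "(map_mat of_int A *\<^sub>v w) $ i = (\<Sum>j\<in>{0..<n}. of_int (c (e i) (e j)) * v (e j))"
      using i by (simp add: A_def w_def scalar_prod_def)
    also have "\<dots> = (\<Sum>j\<in>I. of_int (c (e i) j) * v j)"
      by (rule sum.reindex_bij_betw[OF e])
    finally show "(map_mat of_int A *\<^sub>v w) $ i = (x \<cdot>\<^sub>v w) $ i"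
      using c[OF \<open>e i \<in> I\<close>] i by (simp add: w_def)
  qed (simp add: A_def w_def)
  moreover have "w \<noteq> 0\<^sub>v n"
  proof
    assume w0: "w = 0\<^sub>v n"
    obtain k where "k < n" "e k = i"
      using e \<open>i \<in> I\<close> by (auto simp: bij_betw_def)
    then have "w $ k = v i"
      by (simp add: w_def)
    then have "v i = 0"
      using \<open>k < n\<close> w0 by simp
    with \<open>v i \<noteq> 0\<close> show False by simp
  qed
  ultimately have "eigenvalue (map_mat of_int A) x"
    unfolding eigenvalue_def eigenvector_def by (intro exI[of _ w]) (simp add: w_def A_def)
  then have "poly (char_poly (map_mat of_int A)) x = 0"
    using eigenvalue_root_char_poly[of "map_mat of_int A" n x] A by simp
  then have "poly (map_poly of_int (char_poly A)) x = 0"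
    by (simp add: of_int_hom.char_poly_hom[OF A])
  then show ?thesis
    unfolding algebraic_int_altdef_ipoly using degree_monic_char_poly[OF A] by auto
qed

lemma algebraic_int_power_in_int_span:
  fixes x :: complex
  assumes "algebraic_int x"
  obtains n where "n > 0" "x ^ n \<in> int_span {..<n} (\<lambda>i. x ^ i)"
proof -
  obtain p :: "int poly" where p: "poly (map_poly of_int p) x = 0" "lead_coeff p = 1"
    using assms unfolding algebraic_int_altdef_ipoly by blast
  define n where "n = degree p"
  have "0 = (\<Sum>i\<le>n. of_int (coeff p i) * x ^ i)"
    using p by (simp add: poly_altdef n_def coeff_map_poly degree_map_poly)
  also have "\<dots> = x ^ n + (\<Sum>i<n. of_int (coeff p i) * x ^ i)"
    using p(2) by (simp add: n_def lessThan_Suc_atMost[symmetric])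
  finally have "x ^ n = (\<Sum>i<n. of_int (- coeff p i) * x ^ i)"
    by (simp add: sum_negf add_eq_0_iff2)
  then have "x ^ n \<in> int_span {..<n} (\<lambda>i. x ^ i)"
    using int_span_memI[of "\<lambda>i. - coeff p i"] by metis
  moreover have "n > 0"
  proof (rule Nat.gr0I)
    assume "n = 0"
    then have "p = [:1:]"
      using p(2) by (metis degree_0_id n_def)
    with p(1) show False by (simp add: map_poly_pCons)
  qed
  ultimately show ?thesis
    using that by blast
qed

lemma int_span_mult_right:
  assumes "h \<in> int_span I v"
  shows "h * a \<in> int_span I (\<lambda>i. v i * a)"
  using assms unfolding int_span_def by (auto simp: sum_distrib_right mult.assoc)

lemma int_span_subset:
  assumes "finite I" "f ` J \<subseteq> I" "\<And>j. j \<in> J \<Longrightarrow> w j = v (f j)"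
  shows "int_span J w \<subseteq> int_span I v"
  unfolding int_span_def[of J]
  using assms by (auto intro!: int_span_sum int_span_scale int_span_base)

text \<open>The monomials x^i y^j with i < n and j < m generate a group stable under multiplication
  by x and by y, hence by their sum and product.\<close>

lemma algebraic_int_add_mult:
  fixes x y :: complex
  assumes "algebraic_int x" "algebraic_int y"
  shows "algebraic_int (x + y)" "algebraic_int (x * y)"
proof -
  obtain n where n: "n > 0" "x ^ n \<in> int_span {..<n} (\<lambda>i. x ^ i)"
    using algebraic_int_power_in_int_span[OF assms(1)] .
  obtain m where m: "m > 0" "y ^ m \<in> int_span {..<m} (\<lambda>i. y ^ i)"
    using algebraic_int_power_in_int_span[OF assms(2)] .
  define I where "I = {..<n} \<times> {..<m}"
  define v where "v = (\<lambda>(i, j). x ^ i * y ^ j)"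
  have I: "finite I" "(0, 0) \<in> I" "v (0, 0) \<noteq> 0"
    using n m by (auto simp: I_def v_def)
  have xs: "x * v s \<in> int_span I v" if sI: "s \<in> I" for s
  proof -
    obtain i j where s: "s = (i, j)" "i < n" "j < m"
      using sI by (cases s) (auto simp: I_def)
    have eq: "x * v s = x ^ Suc i * y ^ j"
      by (simp add: s v_def)
    show ?thesis
    proof (cases "Suc i < n")
      case True
      then show ?thesis
        using int_span_base[of I "(Suc i, j)" v] s I unfolding eq by (simp add: I_def v_def)
    next
      case False
      then have "Suc i = n" using s by simp
      then have "x ^ Suc i * y ^ j \<in> int_span {..<n} (\<lambda>i. x ^ i * y ^ j)"
        using int_span_mult_right[OF n(2)] by simp
      also have "\<dots> \<subseteq> int_span I v"
        by (rule int_span_subset[where f = "\<lambda>i. (i, j)"]) (use s in \<open>auto simp: I_def v_def\<close>)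
      finally show ?thesis unfolding eq .
    qed
  qed
  have ys: "y * v s \<in> int_span I v" if sI: "s \<in> I" for s
  proof -
    obtain i j where s: "s = (i, j)" "i < n" "j < m"
      using sI by (cases s) (auto simp: I_def)
    have eq: "y * v s = y ^ Suc j * x ^ i"
      by (simp add: s v_def)
    show ?thesis
    proof (cases "Suc j < m")
      case True
      then show ?thesis
        using int_span_base[of I "(i, Suc j)" v] s I unfolding eq by (simp add: I_def v_def mult.commute)
    next
      case False
      then have "Suc j = m" using s by simp
      then have "y ^ Suc j * x ^ i \<in> int_span {..<m} (\<lambda>j. y ^ j * x ^ i)"
        using int_span_mult_right[OF m(2)] by simp
      also have "\<dots> \<subseteq> int_span I v"
        by (rule int_span_subset[where f = "\<lambda>j. (i, j)"]) (use s in \<open>auto simp: I_def v_def\<close>)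
      finally show ?thesis unfolding eq .
    qed
  qed
  show "algebraic_int (x + y)"
    by (rule algebraic_int_if_int_span_stable[where v = v, OF I])
       (auto simp: distrib_right intro: int_span_add xs ys)
  show "algebraic_int (x * y)"
    by (rule algebraic_int_if_int_span_stable[where v = v, OF I])
       (auto simp: mult.assoc intro: int_span_stableI xs ys)
qed

lemma algebraic_int_diff:
  fixes x y :: complex
  assumes "algebraic_int x" "algebraic_int y"
  shows "algebraic_int (x - y)"
  using algebraic_int_add_mult(1)[of x "- y"] assms by simp

lemma algebraic_int_prod:
  fixes f :: "'i \<Rightarrow> complex"
  assumes "\<And>i. i \<in> I \<Longrightarrow> algebraic_int (f i)"
  shows "algebraic_int (\<Prod>i\<in>I. f i)"
  using assms by (induction I rule: infinite_finite_induct)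
    (auto intro: algebraic_int_add_mult int_imp_algebraic_int)

text \<open>Multiplying an integer equation of \<open>x\<close> by the power n - 1 of its leading
  coefficient \<open>d\<close> turns it into a monic equation for \<open>d * x\<close>.\<close>

lemma algebraic_obtain_int_multiple:
  fixes x :: complex
  assumes "algebraic x"
  obtains d :: int where "d \<noteq> 0" "algebraic_int (of_int d * x)"
proof -
  obtain p where p: "p \<noteq> 0" "poly (map_poly of_int p) x = 0"
    using assms by (erule algebraicE')
  define n where "n = degree p"
  define d where "d = lead_coeff p"
  have d: "d \<noteq> 0" using p by (simp add: d_def)
  have n: "n > 0"
  proof (rule Nat.gr0I)
    assume "n = 0"
    then obtain a where "p = [:a:]" by (metis degree_eq_zeroE n_def)
    with p show False by (simp add: map_poly_pCons)
  qed
  have "(of_int d * x) ^ n = of_int d ^ (n - 1) * (of_int d * x ^ n)"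
    using n by (cases n) (simp_all add: power_mult_distrib)
  also have "of_int d * x ^ n = - (\<Sum>i<n. of_int (coeff p i) * x ^ i)"
  proof -
    have "0 = (\<Sum>i\<le>n. of_int (coeff p i) * x ^ i)"
      using p by (simp add: poly_altdef n_def coeff_map_poly degree_map_poly)
    also have "\<dots> = of_int d * x ^ n + (\<Sum>i<n. of_int (coeff p i) * x ^ i)"
      by (simp add: n_def d_def lessThan_Suc_atMost[symmetric])
    finally show ?thesis by (simp add: add_eq_0_iff2)
  qed
  also have "of_int d ^ (n - 1) * (- (\<Sum>i<n. of_int (coeff p i) * x ^ i)) =
      (\<Sum>i<n. of_int (- coeff p i * d ^ (n - 1 - i)) * (of_int d * x) ^ i)"
  proof -
    have *: "of_int d ^ (n - 1) = (of_int d ^ (n - 1 - i) * of_int d ^ i :: complex)" if "i < n" for i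
      using that by (simp flip: power_add)
    show ?thesis
      unfolding sum_negf[symmetric] sum_distrib_left
    proof (intro sum.cong refl)
      fix i assume "i \<in> {..<n}"
      then show "of_int d ^ (n - 1) * - (of_int (coeff p i) * x ^ i) =
        of_int (- coeff p i * d ^ (n - 1 - i)) * (of_int d * x) ^ i"
        by (subst *) (auto simp: power_mult_distrib)
    qed
  qed
  finally have *: "(of_int d * x) ^ n \<in> int_span {..<n} (\<lambda>i. (of_int d * x) ^ i)"
    using int_span_memI[of "\<lambda>i. - coeff p i * d ^ (n - 1 - i)"] by metis
  have "algebraic_int (of_int d * x)"
  proof (rule algebraic_int_if_int_span_stable)
    show "finite {..<n}" "0 \<in> {..<n}" "(of_int d * x) ^ 0 \<noteq> 0"
      using n by auto
    fix i assume i: "i \<in> {..<n}"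
    have "(of_int d * x) ^ Suc i \<in> int_span {..<n} (\<lambda>i. (of_int d * x) ^ i)"
    proof (cases "Suc i = n")
      case True
      with * show ?thesis by metis
    next
      case False
      with i show ?thesis by (intro int_span_base) auto
    qed
    then show "of_int d * x * (of_int d * x) ^ i \<in> int_span {..<n} (\<lambda>i. (of_int d * x) ^ i)"
      by (simp only: power_Suc)
  qed
  with d that show ?thesis by blast
qed

section \<open>A determinant criterion from a prime element\<close>

text \<open>Divisibility is phrased as membership of a quotient in \<open>R\<close>, so the
  valuation needs no ideals or localization. \<open>p_separated\<close> says that only 0 is
  divisible by all powers of \<open>p\<close>.\<close>

locale ring_with_prime =
  fixes R :: "complex set" and p :: complex
  assumes one_mem: "1 \<in> R"
    and add_mem: "x \<in> R \<Longrightarrow> y \<in> R \<Longrightarrow> x + y \<in> R"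
    and uminus_mem: "x \<in> R \<Longrightarrow> - x \<in> R"
    and mult_mem: "x \<in> R \<Longrightarrow> y \<in> R \<Longrightarrow> x * y \<in> R"
    and p_mem: "p \<in> R" and p_nonzero: "p \<noteq> 0"
    and p_prime: "x \<in> R \<Longrightarrow> y \<in> R \<Longrightarrow> x * y / p \<in> R \<Longrightarrow> x / p \<in> R \<or> y / p \<in> R"
    and p_separated: "x \<in> R \<Longrightarrow> x \<noteq> 0 \<Longrightarrow> \<exists>m. x / p ^ m \<notin> R"
begin

text \<open>The p-adic valuation: \<open>Suc m\<close> is the first exponent at which divisibility
  fails. At 0 no exponent fails, so the value there is unspecified.\<close>

definition val :: "complex \<Rightarrow> nat" where
  "val x = (LEAST m. x / p ^ Suc m \<notin> R)"

lemma zero_mem: "0 \<in> R"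
  using add_mem[OF one_mem uminus_mem[OF one_mem]] by simp

lemma power_p_mem: "p ^ m \<in> R"
  by (induction m) (auto intro: one_mem mult_mem p_mem)

lemma prod_mem: "(\<And>i. i \<in> I \<Longrightarrow> f i \<in> R) \<Longrightarrow> prod f I \<in> R"
  by (induction I rule: infinite_finite_induct) (auto intro: one_mem mult_mem)

lemma sum_mem: "(\<And>i. i \<in> I \<Longrightarrow> f i \<in> R) \<Longrightarrow> sum f I \<in> R"
  by (induction I rule: infinite_finite_induct) (auto intro: zero_mem add_mem)

lemma
  assumes "x \<in> R" "x \<noteq> 0"
  shows val_div_mem: "x / p ^ val x \<in> R"
    and val_Suc_div_notin: "x / p ^ Suc (val x) \<notin> R"
proof -
  obtain m where m: "x / p ^ m \<notin> R"
    using p_separated assms by blast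
  with assms have "m \<noteq> 0"
    by (intro notI) simp
  then have ex: "x / p ^ Suc (m - 1) \<notin> R"
    using m by simp
  show "x / p ^ Suc (val x) \<notin> R"
    unfolding val_def by (rule LeastI[where P = "\<lambda>m. x / p ^ Suc m \<notin> R", OF ex])
  show "x / p ^ val x \<in> R"
  proof (cases "val x")
    case 0
    with assms show ?thesis by simp
  next
    case (Suc k)
    then have "k < (LEAST m. x / p ^ Suc m \<notin> R)"
      by (simp add: val_def)
    from not_less_Least[OF this] Suc show ?thesis
      by simp
  qed
qed

lemma div_mono:
  assumes "x / p ^ m \<in> R" "k \<le> m"
  shows "x / p ^ k \<in> R"
proof -
  have "x / p ^ k = p ^ (m - k) * (x / p ^ m)"
    using assms p_nonzero by (simp add: power_diff)
  with assms show ?thesis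
    by (simp only: mult_mem power_p_mem)
qed

lemma val_eqI:
  assumes "x / p ^ m \<in> R" "x / p ^ Suc m \<notin> R"
  shows "val x = m"
  unfolding val_def
proof (rule Least_equality)
  fix k assume "x / p ^ Suc k \<notin> R"
  then show "m \<le> k"
    using div_mono[OF assms(1), of "Suc k"] by (meson not_less_eq_eq)
qed (rule assms)

lemma val_mult:
  assumes "x \<in> R" "x \<noteq> 0" "y \<in> R" "y \<noteq> 0"
  shows "val (x * y) = val x + val y"
proof (rule val_eqI)
  have eq: "x * y / p ^ (val x + val y) = (x / p ^ val x) * (y / p ^ val y)"
    by (simp add: power_add)
  show "x * y / p ^ (val x + val y) \<in> R"
    unfolding eq by (intro mult_mem val_div_mem assms)
  show "x * y / p ^ Suc (val x + val y) \<notin> R"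
  proof
    assume "x * y / p ^ Suc (val x + val y) \<in> R"
    then have "(x / p ^ val x) * (y / p ^ val y) / p \<in> R"
      by (simp add: power_add mult_ac)
    then have "x / p ^ val x / p \<in> R \<or> y / p ^ val y / p \<in> R"
      by (intro p_prime val_div_mem assms)
    then show False
      using val_Suc_div_notin[OF assms(1,2)] val_Suc_div_notin[OF assms(3,4)]
      by (simp add: mult.commute)
  qed
qed

lemma val_1: "val 1 = 0"
proof -
  have "val (1 * 1) = val 1 + val 1"
    by (intro val_mult one_mem) auto
  then show ?thesis by simp
qed

lemma val_p: "val p = 1"
proof (rule val_eqI)
  show "p / p ^ 1 \<in> R"
    using p_nonzero one_mem by simp
  have "1 / p ^ Suc 0 \<notin> R"
    using val_Suc_div_notin[OF one_mem] by (simp add: val_1)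
  then show "p / p ^ Suc 1 \<notin> R"
    using p_nonzero by simp
qed

lemma val_power_p: "val (p ^ m) = m"
  by (induction m) (auto simp: val_1 val_mult val_p p_mem power_p_mem p_nonzero)

lemma val_prod:
  assumes "\<And>i. i \<in> I \<Longrightarrow> f i \<in> R \<and> f i \<noteq> 0"
  shows "val (prod f I) = (\<Sum>i\<in>I. val (f i))"
  using assms
proof (induction I rule: infinite_finite_induct)
  case (insert i I)
  then have "prod f I \<in> R" "prod f I \<noteq> 0"
    by (auto intro: prod_mem)
  with insert show ?case
    by (simp add: val_mult)
qed (auto simp: val_1)

text \<open>The weights \<open>\<alpha>\<close>, \<open>\<beta>\<close> form a dual solution certifying that \<open>\<pi>\<close> is the only permutation
  whose term in the Leibniz expansion has minimal valuation.\<close>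

lemma det_nonzero_if_dominant_permutation:
  assumes A: "A \<in> carrier_mat n n" and "N > 0"
    and mem: "\<And>r c. r < n \<Longrightarrow> c < n \<Longrightarrow> A $$ (r, c) \<in> R"
    and \<pi>: "\<pi> permutes {0..<n}"
    and dominant: "\<And>r. r < n \<Longrightarrow>
      A $$ (r, \<pi> r) \<noteq> 0 \<and> N * val (A $$ (r, \<pi> r)) + \<beta> (\<pi> r) = \<alpha> r"
    and other: "\<And>r c. r < n \<Longrightarrow> c < n \<Longrightarrow> A $$ (r, c) \<noteq> 0 \<Longrightarrow> c \<noteq> \<pi> r \<Longrightarrow>
      \<alpha> r < N * val (A $$ (r, c)) + \<beta> c"
  shows "det A \<noteq> 0"
proof
  assume "det A = 0"
  define T where "T q = (\<Prod>r = 0..<n. A $$ (r, q r))" for q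
  define P where "P = {q. q permutes {0..<n}}"
  have "finite P" "\<pi> \<in> P"
    using \<pi> by (auto simp: P_def finite_permutations)
  have q_less: "q r < n" if "q \<in> P" "r < n" for q r
    using that permutes_in_image[of q "{0..<n}" r] by (auto simp: P_def)
  have sum_\<beta>: "(\<Sum>r = 0..<n. \<beta> (q r)) = (\<Sum>c = 0..<n. \<beta> c)" if "q \<in> P" for q
    using that sum.permute[of q "{0..<n}" \<beta>] by (simp add: P_def o_def)
  have val_T: "N * val (T q) + (\<Sum>c = 0..<n. \<beta> c) =
      (\<Sum>r = 0..<n. N * val (A $$ (r, q r)) + \<beta> (q r))"
    if "q \<in> P" "T q \<noteq> 0" for q
  proof -
    have "val (T q) = (\<Sum>r = 0..<n. val (A $$ (r, q r)))"
      unfolding T_def using that by (intro val_prod) (auto simp: T_def intro: mem q_less)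
    then show ?thesis
      by (simp add: sum.distrib sum_distrib_left sum_\<beta>[OF that(1)])
  qed
  have "T \<pi> \<in> R"
    unfolding T_def by (intro prod_mem mem q_less[OF \<open>\<pi> \<in> P\<close>]) auto
  moreover have "A $$ (r, \<pi> r) \<noteq> 0" if "r < n" for r
    using dominant[OF that] by blast
  then have "T \<pi> \<noteq> 0"
    by (simp add: T_def)
  ultimately have T_\<pi>: "T \<pi> \<in> R" "T \<pi> \<noteq> 0"
    by auto
  define W where "W = val (T \<pi>)"
  have W: "N * W + (\<Sum>c = 0..<n. \<beta> c) = (\<Sum>r = 0..<n. \<alpha> r)"
    using val_T[OF \<open>\<pi> \<in> P\<close> T_\<pi>(2)] dominant by (simp add: W_def)
  \<comment> \<open>Strictly larger valuation means divisibility by one more power of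
    \<open>p\<close>; the dominance conditions give this for every permutation that differs from
    \<pi> somewhere.\<close>
  have T_other: "T q / p ^ Suc W \<in> R" if q: "q \<in> P" "q \<noteq> \<pi>" for q
  proof (cases "T q = 0")
    case True
    then show ?thesis by (simp add: zero_mem)
  next
    case False
    then have nz: "A $$ (r, q r) \<noteq> 0" if "r < n" for r
      using that by (auto simp: T_def)
    obtain r0 where r0: "q r0 \<noteq> \<pi> r0"
      using q(2) by blast
    then have "r0 < n"
      using q \<pi> by (metis P_def atLeastLessThan_iff le0 mem_Collect_eq permutes_not_in)
    have "(\<Sum>r = 0..<n. \<alpha> r) < (\<Sum>r = 0..<n. N * val (A $$ (r, q r)) + \<beta> (q r))"
    proof (rule sum_strict_mono_ex1)
      show "\<forall>r\<in>{0..<n}. \<alpha> r \<le> N * val (A $$ (r, q r)) + \<beta> (q r)"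
      proof
        fix r assume "r \<in> {0..<n}"
        then show "\<alpha> r \<le> N * val (A $$ (r, q r)) + \<beta> (q r)"
          using dominant[of r] other[of r "q r"] q_less[OF q(1), of r] nz[of r]
          by (cases "q r = \<pi> r") auto
      qed
      show "\<exists>r\<in>{0..<n}. \<alpha> r < N * val (A $$ (r, q r)) + \<beta> (q r)"
        using other[of r0 "q r0"] q_less[OF q(1)] nz r0 \<open>r0 < n\<close> by auto
    qed simp
    then have "N * W < N * val (T q)"
      using W val_T[OF q(1) False] by linarith
    then have "Suc W \<le> val (T q)"
      by simp
    moreover have "T q \<in> R"
      unfolding T_def by (intro prod_mem mem q_less[OF q(1)]) auto
    ultimately show ?thesis
      using div_mono val_div_mem False by blast
  qed
  have "(\<Sum>q\<in>P. signof q * T q) = 0"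
    using \<open>det A = 0\<close> A unfolding det_def' [OF A] P_def T_def by simp
  \<comment> \<open>If the determinant vanished, the dominant term would be minus the sum of the
    others, hence divisible by \<open>p ^ Suc W\<close>, against
    \<open>W = val (T \<pi>)\<close>.\<close>
  then have "signof \<pi> * T \<pi> = - (\<Sum>q\<in>P - {\<pi>}. signof q * T q)"
    using sum.remove[OF \<open>finite P\<close> \<open>\<pi> \<in> P\<close>, of "\<lambda>q. signof q * T q"]
    by (simp add: eq_neg_iff_add_eq_0)
  then have "signof \<pi> * T \<pi> / p ^ Suc W = - (\<Sum>q\<in>P - {\<pi>}. signof q * (T q / p ^ Suc W))"
    by (simp add: sum_divide_distrib)
  also have "\<dots> \<in> R"
    using T_other uminus_mem by (intro uminus_mem sum_mem) (auto simp: sign_def)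
  finally have "signof \<pi> * T \<pi> / p ^ Suc W \<in> R" .
  then have "T \<pi> / p ^ Suc W \<in> R"
    using uminus_mem[of "- (T \<pi> / p ^ Suc W)"] by (auto simp: sign_def split: if_splits)
  then show False
    using val_Suc_div_notin[OF T_\<pi>] by (simp add: W_def)
qed

end

section \<open>Subfields of the complex numbers\<close>

lemma field_complex_ring: "Ring.field complex_ring"
  by (rule field_from_type_algebra)

lemma ring_complex_ring: "Ring.ring complex_ring"
  by (rule ring_from_type_algebra)

lemma complex_ring_simps:
  "carrier complex_ring = UNIV" "x \<otimes>\<^bsub>complex_ring\<^esub> y = x * y" "x \<oplus>\<^bsub>complex_ring\<^esub> y = x + y"
  "\<zero>\<^bsub>complex_ring\<^esub> = 0" "\<one>\<^bsub>complex_ring\<^esub> = 1"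
  by (simp_all add: ring_of_type_algebra_def)

lemma a_inv_complex_ring: "\<ominus>\<^bsub>complex_ring\<^esub> x = - x"
proof -
  interpret ring complex_ring by (rule ring_complex_ring)
  have "- x \<oplus>\<^bsub>complex_ring\<^esub> x = \<zero>\<^bsub>complex_ring\<^esub>"
    by (simp add: complex_ring_simps)
  from minus_equality[OF this] show ?thesis
    by (simp add: complex_ring_simps)
qed

lemma m_inv_complex_ring:
  assumes "x \<noteq> 0"
  shows "inv\<^bsub>complex_ring\<^esub> x = inverse x"
proof -
  interpret Ring.field complex_ring by (rule field_complex_ring)
  have "inverse x \<otimes>\<^bsub>complex_ring\<^esub> x = \<one>\<^bsub>complex_ring\<^esub>"
    "x \<otimes>\<^bsub>complex_ring\<^esub> inverse x = \<one>\<^bsub>complex_ring\<^esub>"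
    using assms by (simp_all add: complex_ring_simps)
  from inv_unique'[OF _ _ this(2,1)] show ?thesis
    by (simp add: complex_ring_simps)
qed

locale complex_subfield =
  fixes K :: "complex set"
  assumes subfield: "subfield K complex_ring"
begin

lemma zero_mem: "0 \<in> K" and one_mem: "1 \<in> K"
  and uminus_mem: "x \<in> K \<Longrightarrow> - x \<in> K"
  and add_mem: "x \<in> K \<Longrightarrow> y \<in> K \<Longrightarrow> x + y \<in> K"
  and mult_mem: "x \<in> K \<Longrightarrow> y \<in> K \<Longrightarrow> x * y \<in> K"
  using subringE[OF subfieldE(1)[OF subfield]]
  by (auto simp: complex_ring_simps a_inv_complex_ring)

lemma inverse_mem: "x \<in> K \<Longrightarrow> inverse x \<in> K"
  using ring.subfield_m_inv(1)[OF ring_complex_ring subfield, of x] m_inv_complex_ring[of x]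
  by (cases "x = 0") (auto simp: complex_ring_simps zero_mem)

lemma diff_mem: "x \<in> K \<Longrightarrow> y \<in> K \<Longrightarrow> x - y \<in> K"
  using add_mem[of x "- y"] uminus_mem[of y] by simp

lemma divide_mem: "x \<in> K \<Longrightarrow> y \<in> K \<Longrightarrow> x / y \<in> K"
  by (simp add: divide_inverse mult_mem inverse_mem)

lemma power_mem: "x \<in> K \<Longrightarrow> x ^ n \<in> K"
  by (induction n) (auto intro: one_mem mult_mem)

lemma sum_mem: "(\<And>i. i \<in> I \<Longrightarrow> f i \<in> K) \<Longrightarrow> sum f I \<in> K"
  by (induction I rule: infinite_finite_induct) (auto intro: zero_mem add_mem)

lemma prod_mem: "(\<And>i. i \<in> I \<Longrightarrow> f i \<in> K) \<Longrightarrow> prod f I \<in> K"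
  by (induction I rule: infinite_finite_induct) (auto intro: one_mem mult_mem)

lemma of_int_mem: "of_int n \<in> K"
proof -
  have "of_nat m \<in> K" for m
    by (induction m) (auto intro: zero_mem one_mem add_mem)
  then show ?thesis
    by (cases n) (auto intro: uminus_mem simp del: of_nat_Suc)
qed

lemma Rats_subset: "\<rat> \<subseteq> K"
  by (auto elim!: Rats_cases' intro: divide_mem of_int_mem)

end

lemma combine_complex_ring:
  "length Ks = length Us \<Longrightarrow>
    ring.combine complex_ring Ks Us = (\<Sum>i<length Us. Ks ! i * Us ! i)"
proof (induction Ks Us rule: list_induct2)
  case Nil
  then show ?case
    by (simp add: ring.combine.simps[OF ring_complex_ring] complex_ring_simps)
next
  case (Cons k Ks u Us)
  then show ?case
    by (simp add: ring.combine.simps[OF ring_complex_ring] complex_ring_simps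
        sum.lessThan_Suc_shift del: sum.lessThan_Suc)
qed

lemma dimension_obtain_basis:
  assumes "subfield K complex_ring" "ring.dimension complex_ring n K E"
  obtains e :: "nat \<Rightarrow> complex" where
    "\<And>x. x \<in> E \<Longrightarrow> \<exists>c. (\<forall>i<n. c i \<in> K) \<and> x = (\<Sum>i<n. c i * e i)"
    "\<And>i. i < n \<Longrightarrow> e i \<in> E"
    "\<And>c. (\<And>i. i < n \<Longrightarrow> c i \<in> K) \<Longrightarrow> (\<Sum>i<n. c i * e i) = 0 \<Longrightarrow> \<forall>i<n. c i = 0"
proof -
  interpret CR: ring complex_ring by (rule ring_complex_ring)
  obtain Us where Us: "set Us \<subseteq> carrier complex_ring" "CR.independent K Us" "length Us = n"
      "CR.Span K Us = E"
    using CR.exists_base[OF assms] by blast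
  show ?thesis
  proof (rule that[of "\<lambda>i. Us ! i"])
    fix x assume "x \<in> E"
    then obtain Ks where "set Ks \<subseteq> K" "length Ks = length Us" "x = CR.combine Ks Us"
      using CR.Span_mem_iff_length_version[OF assms(1) Us(1)] Us(4) by blast
    then show "\<exists>c. (\<forall>i<n. c i \<in> K) \<and> x = (\<Sum>i<n. c i * Us ! i)"
      using Us(3) combine_complex_ring[of Ks Us] by (intro exI[of _ "\<lambda>i. Ks ! i"]) auto
  next
    fix i assume "i < n"
    then show "Us ! i \<in> E"
      using CR.Span_base_incl[OF assms(1) Us(1)] Us(3,4) by auto
  next
    fix c :: "nat \<Rightarrow> complex"
    assume c: "\<And>i. i < n \<Longrightarrow> c i \<in> K" "(\<Sum>i<n. c i * Us ! i) = 0"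
    define Ks where "Ks = map c [0..<n]"
    have "set Ks \<subseteq> K" "length Ks = n"
      using c by (auto simp: Ks_def)
    moreover have "CR.combine Ks Us = \<zero>\<^bsub>complex_ring\<^esub>"
      using c Us(3) by (simp add: combine_complex_ring Ks_def complex_ring_simps)
    ultimately have "set (take (length Us) Ks) \<subseteq> {\<zero>\<^bsub>complex_ring\<^esub>}"
      using CR.independent_imp_trivial_combine[OF assms(1) Us(2)] by blast
    then show "\<forall>i<n. c i = 0"
      using Us(3) by (simp add: Ks_def complex_ring_simps image_subset_iff)
  qed
qed

lemma dimension_dependent:
  assumes "subfield K complex_ring" "ring.dimension complex_ring n K E"
    and "n < m" "\<And>i. i < m \<Longrightarrow> f i \<in> E"
  shows "\<exists>c. (\<forall>i<m. c i \<in> K) \<and> (\<exists>i<m. c i \<noteq> 0) \<and> (\<Sum>i<m. c i * f i) = (0 :: complex)"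
proof -
  interpret CR: ring complex_ring by (rule ring_complex_ring)
  define Us where "Us = map f [0..<m]"
  have Us: "set Us \<subseteq> E" "length Us = m" "set Us \<subseteq> carrier complex_ring"
    using assms by (auto simp: Us_def complex_ring_simps)
  have "CR.dependent K Us"
    using CR.independent_length_le_dimension[OF assms(1,2) _ Us(1)] Us(2) assms(3) by auto
  then obtain Ks where Ks: "length Ks = length Us" "CR.combine Ks Us = \<zero>\<^bsub>complex_ring\<^esub>"
      "set Ks \<subseteq> K" "set Ks \<noteq> {\<zero>\<^bsub>complex_ring\<^esub>}"
    using CR.dependent_imp_non_trivial_combine[OF assms(1) Us(3)] by blast
  have "Ks \<noteq> []"
    using Ks(1) Us(2) assms(3) by auto
  then have "\<exists>k\<in>set Ks. k \<noteq> 0"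
    using Ks(4) by (auto simp: complex_ring_simps) (metis list.set_sel(1))
  then have "\<exists>i<m. Ks ! i \<noteq> 0"
    using Ks(1) Us(2) by (auto simp: in_set_conv_nth)
  moreover have "(\<Sum>i<m. Ks ! i * f i) = 0"
    using Ks(1,2) Us(2) by (simp add: combine_complex_ring complex_ring_simps Us_def)
  moreover have "Ks ! i \<in> K" if "i < m" for i
    using Ks(1,3) Us(2) that by (metis nth_mem subsetD)
  ultimately show ?thesis
    by blast
qed

text \<open>The n + 1 powers 1, x, ..., x^n are dependent in a space of dimension n. The polynomial
  may be reducible; its degree bound is what root counting uses.\<close>

lemma dimension_power_relation:
  assumes "subfield K complex_ring" "subfield E complex_ring" "ring.dimension complex_ring n K E"
    and "x \<in> E"
  obtains P where "P \<noteq> 0" "degree P \<le> n" "\<And>i. coeff P i \<in> K" "poly P x = (0 :: complex)"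
proof -
  interpret K: complex_subfield K by (rule complex_subfield.intro[OF assms(1)])
  interpret E: complex_subfield E by (rule complex_subfield.intro[OF assms(2)])
  have "\<And>i. i < Suc n \<Longrightarrow> x ^ i \<in> E"
    by (rule E.power_mem[OF assms(4)])
  from dimension_dependent[where f = "\<lambda>i. x ^ i", OF assms(1,3) lessI this]
  obtain c where c: "\<forall>i<Suc n. c i \<in> K" "\<exists>i<Suc n. c i \<noteq> 0"
      "(\<Sum>i<Suc n. c i * x ^ i) = 0"
    by auto
  define P where "P = (\<Sum>i<Suc n. monom (c i) i)"
  have coeff: "coeff P i = (if i < Suc n then c i else 0)" for i
    unfolding P_def coeff_sum by (simp add: coeff_monom)
  show ?thesis
  proof (rule that[of P])
    show "P \<noteq> 0"
      using c(2) coeff by (metis coeff_0)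
    show "degree P \<le> n"
      by (rule degree_le) (simp add: coeff)
    show "coeff P i \<in> K" for i
      using c(1) by (simp add: coeff K.zero_mem)
    show "poly P x = 0"
      using c(3) by (simp add: P_def poly_sum poly_monom)
  qed
qed

lemma algebraic_if_finite_dimension:
  assumes "subfield \<rat> complex_ring" "subfield E complex_ring" "ring.dimension complex_ring n \<rat> E"
    and "x \<in> E"
  shows "algebraic x"
  using dimension_power_relation[OF assms] unfolding algebraic_altdef by metis

section \<open>Absolute values of integers in an imaginary quadratic field\<close>

text \<open>A real \<open>z\<close> is rational: in a relation between 1, z and a nonreal \<theta>
  the coefficient of \<theta> must vanish. A nonreal \<open>z\<close> is a root of a rational
  quadratic whose other root is \<open>cnj z\<close>, so the product of the two is a quotient of
  coefficients.\<close>

lemma imaginary_quadratic_norm_rational: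
  assumes "imaginary_quadratic K" "z \<in> K"
  shows "z * cnj z \<in> \<rat>"
proof -
  have Q: "subfield \<rat> complex_ring" "subfield K complex_ring" "ring.dimension complex_ring 2 \<rat> K"
    using assms by (auto simp: imaginary_quadratic_def field_extension_of_degree_def)
  interpret K: complex_subfield K by (rule complex_subfield.intro[OF Q(2)])
  obtain \<theta> where \<theta>: "\<theta> \<in> K" "\<theta> \<notin> \<real>"
    using assms by (auto simp: imaginary_quadratic_def)
  have dep: "\<exists>a b c. a \<in> \<rat> \<and> b \<in> \<rat> \<and> c \<in> \<rat> \<and> (a \<noteq> 0 \<or> b \<noteq> 0 \<or> c \<noteq> 0) \<and> a + b * z + c * y = 0"
    if "y \<in> K" for y
  proof -
    define f where "f = (\<lambda>i :: nat. if i = 0 then 1 else if i = 1 then z else y)"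
    have "\<And>i. i < 3 \<Longrightarrow> f i \<in> K"
      using that assms(2) by (auto simp: f_def K.one_mem)
    then obtain d where d: "\<And>i. i < 3 \<Longrightarrow> d i \<in> \<rat>" "\<exists>i<3. d i \<noteq> 0" "(\<Sum>i<3. d i * f i) = 0"
      using dimension_dependent[OF Q(1,3), of 3 f] by auto
    obtain i where i: "i < 3" "d i \<noteq> 0"
      using d(2) by blast
    then have "i = 0 \<or> i = 1 \<or> i = 2"
      by linarith
    with i have "d 0 \<noteq> 0 \<or> d 1 \<noteq> 0 \<or> d 2 \<noteq> 0"
      by metis
    moreover have "(\<Sum>i<3. d i * f i) = d 0 + d 1 * z + d 2 * y"
      by (simp add: f_def numeral_3_eq_3 numeral_2_eq_2)
    moreover have "d 0 \<in> \<rat>" "d 1 \<in> \<rat>" "d 2 \<in> \<rat>"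
      by (rule d(1), simp)+
    ultimately show ?thesis
      using d(3) by metis
  qed
  have real: "x \<in> \<real>" if "x \<in> \<rat>" for x :: complex
    using that by (auto elim!: Rats_cases')
  show ?thesis
  proof (cases "z \<in> \<real>")
    case True
    obtain a b c where abc: "a \<in> \<rat>" "b \<in> \<rat>" "c \<in> \<rat>" "a \<noteq> 0 \<or> b \<noteq> 0 \<or> c \<noteq> 0" "a + b * z + c * \<theta> = 0"
      using dep[OF \<theta>(1)] by blast
    have "c = 0"
    proof (rule ccontr)
      assume "c \<noteq> 0"
      with abc(5) have "\<theta> = - (a + b * z) / c"
        by (simp add: field_simps eq_neg_iff_add_eq_0)
      then have "\<theta> \<in> \<real>"
        using True abc real by simp
      with \<theta> show False by simp
    qed
    with abc have "b \<noteq> 0" by auto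
    with abc \<open>c = 0\<close> have "z = - a / b"
      by (simp add: field_simps eq_neg_iff_add_eq_0)
    then have "z \<in> \<rat>"
      using abc by simp
    moreover have "cnj z = z"
      using True by (simp add: Reals_cnj_iff)
    ultimately show ?thesis by simp
  next
    case False
    obtain a b c where abc: "a \<in> \<rat>" "b \<in> \<rat>" "c \<in> \<rat>" "a \<noteq> 0 \<or> b \<noteq> 0 \<or> c \<noteq> 0"
        "a + b * z + c * z\<^sup>2 = 0"
      using dep[OF K.power_mem[OF assms(2)]] by blast
    have cnj: "cnj a = a" "cnj b = b" "cnj c = c"
      using abc real by (simp_all add: Reals_cnj_iff[symmetric])
    have "cnj (a + b * z + c * z\<^sup>2) = 0"
      by (simp only: abc(5)) simp
    then have cz: "a + b * cnj z + c * (cnj z)\<^sup>2 = 0"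
      by (simp add: cnj)
    have "cnj z \<noteq> z"
      using False by (simp add: Reals_cnj_iff)
    \<comment> \<open>Vieta: subtracting the conjugate equation and cancelling
      \<open>z - cnj z\<close> gives the sum of the roots, and substituting it back gives their
      product.\<close>
    have "(z - cnj z) * (b + c * (z + cnj z)) = (a + b * z + c * z\<^sup>2) - (a + b * cnj z + c * (cnj z)\<^sup>2)"
      by (simp add: algebra_simps power2_eq_square)
    then have b: "b = - c * (z + cnj z)"
      using \<open>cnj z \<noteq> z\<close> abc(5) cz by (simp add: eq_neg_iff_add_eq_0)
    have a: "a = c * (z * cnj z)"
      using abc(5) unfolding b by (simp add: algebra_simps power2_eq_square)
    have "c \<noteq> 0"
      using a b abc(4) by auto
    then have "z * cnj z = a / c"
      using a by simp
    then show ?thesis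
      using abc by simp
  qed
qed

text \<open>The square of \<open>cmod z\<close> is a rational algebraic integer, so a positive
  integer.\<close>

lemma imaginary_quadratic_norm_ge_1:
  assumes "imaginary_quadratic K" "z \<in> K" "algebraic_int z" "z \<noteq> 0"
  shows "cmod z \<ge> 1"
proof -
  have "z * cnj z \<in> \<int>"
    using assms by (intro rational_algebraic_int_is_int imaginary_quadratic_norm_rational
        algebraic_int_add_mult) auto
  then obtain n :: int where n: "z * cnj z = of_int n"
    by (auto elim: Ints_cases)
  then have "complex_of_real ((cmod z)\<^sup>2) = complex_of_real (of_int n)"
    by (simp only: complex_norm_square of_real_of_int_eq)
  then have eq: "(cmod z)\<^sup>2 = of_int n"
    by (simp only: of_real_eq_iff)
  moreover have "(cmod z)\<^sup>2 > 0"
    using assms(4) by simp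
  ultimately have "n \<ge> 1"
    by linarith
  then have "1\<^sup>2 \<le> (cmod z)\<^sup>2"
    unfolding eq by simp
  then show ?thesis
    by (rule power2_le_imp_le) simp
qed

section \<open>Automorphisms\<close>

text \<open>The laws are required on \<open>L\<close> only, since elements of the Galois group are
  \<open>undefined\<close> outside it. Iterates such as \<open>\<sigma> ^^ 0\<close> need not be
  extensional, so they may fall outside the group as represented; this predicate is stable under
  iteration.\<close>

locale subfield_endo = K: complex_subfield K + L: complex_subfield L
  for K L :: "complex set" +
  fixes f :: "complex \<Rightarrow> complex"
  assumes K_subset: "K \<subseteq> L"
    and maps: "x \<in> L \<Longrightarrow> f x \<in> L"
    and add: "x \<in> L \<Longrightarrow> y \<in> L \<Longrightarrow> f (x + y) = f x + f y"
    and mult: "x \<in> L \<Longrightarrow> y \<in> L \<Longrightarrow> f (x * y) = f x * f y"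
    and fix_K: "x \<in> K \<Longrightarrow> f x = x"
begin

lemma zero: "f 0 = 0" and one: "f 1 = 1"
  by (simp_all add: fix_K K.zero_mem K.one_mem)

lemma fix_Rats: "x \<in> \<rat> \<Longrightarrow> f x = x"
  using K.Rats_subset by (auto intro: fix_K)

lemma uminus: "x \<in> L \<Longrightarrow> f (- x) = - f x"
  using add[of x "- x"] by (simp add: L.uminus_mem zero eq_neg_iff_add_eq_0 add.commute)

lemma diff: "x \<in> L \<Longrightarrow> y \<in> L \<Longrightarrow> f (x - y) = f x - f y"
  using add[of x "- y"] by (simp add: L.uminus_mem uminus)

lemma eq_0_iff: "x \<in> L \<Longrightarrow> f x = 0 \<longleftrightarrow> x = 0"
proof
  assume "x \<in> L" "f x = 0"
  then show "x = 0"
    using mult[of x "inverse x"] L.inverse_mem[of x] one by (cases "x = 0") auto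
qed (simp add: zero)

lemma inj: "x \<in> L \<Longrightarrow> y \<in> L \<Longrightarrow> f x = f y \<Longrightarrow> x = y"
  using eq_0_iff[of "x - y"] by (simp add: L.diff_mem diff)

lemma divide: "x \<in> L \<Longrightarrow> y \<in> L \<Longrightarrow> f (x / y) = f x / f y"
  using mult[of "x / y" y] eq_0_iff[of y]
  by (cases "y = 0") (auto simp: zero L.divide_mem)

lemma sum: "(\<And>i. i \<in> I \<Longrightarrow> g i \<in> L) \<Longrightarrow> f (\<Sum>i\<in>I. g i) = (\<Sum>i\<in>I. f (g i))"
  by (induction I rule: infinite_finite_induct) (auto simp: zero add L.sum_mem)

lemma prod: "(\<And>i. i \<in> I \<Longrightarrow> g i \<in> L) \<Longrightarrow> f (\<Prod>i\<in>I. g i) = (\<Prod>i\<in>I. f (g i))"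
  by (induction I rule: infinite_finite_induct) (auto simp: one mult L.prod_mem)

lemma power: "x \<in> L \<Longrightarrow> f (x ^ m) = f x ^ m"
  by (induction m) (auto simp: one mult L.power_mem)

lemma poly:
  assumes "\<And>i. coeff P i \<in> K" "x \<in> L"
  shows "f (poly P x) = poly P (f x)"
proof -
  have "coeff P i \<in> L" for i
    using assms K_subset by blast
  then show ?thesis
    using assms(2) fix_K[OF assms(1)]
    by (simp add: poly_altdef sum mult power L.mult_mem L.power_mem)
qed

text \<open>An integer polynomial commutes with \<open>f\<close>, and \<open>f\<close> has trivial
  kernel on \<open>L\<close>, so it vanishes at \<open>f x\<close> exactly when it vanishes at
  \<open>x\<close>.\<close>

lemma algebraic_int_iff:
  assumes "x \<in> L"
  shows "algebraic_int (f x) \<longleftrightarrow> algebraic_int x"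
proof -
  have "poly P (f x) = 0 \<longleftrightarrow> poly P x = 0" if "\<forall>i. coeff P i \<in> \<int>" for P
  proof -
    have K: "coeff P i \<in> K" for i
      using that K.of_int_mem by (metis Ints_cases)
    then have "poly P x \<in> L"
      using K_subset assms by (auto simp: poly_altdef intro!: L.sum_mem L.mult_mem L.power_mem)
    then show ?thesis
      using poly[OF K assms] eq_0_iff by metis
  qed
  then show ?thesis
    by (auto simp: algebraic_int.simps)
qed

lemma funpow: "subfield_endo K L (f ^^ i)"
proof (induction i)
  case 0
  show ?case
    by unfold_locales (use K_subset in auto)
next
  case (Suc i)
  then interpret i: subfield_endo K L "f ^^ i" .
  show ?case
    by unfold_locales (use K_subset in \<open>auto simp: maps i.maps add i.add mult i.mult fix_K i.fix_K\<close>)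
qed

end

section \<open>The Galois group and the fixed field of a generator\<close>

lemma carrier_galois_group_iff:
  assumes "subfield K complex_ring" "subfield L complex_ring" "K \<subseteq> L"
  shows "f \<in> carrier (galois_group L K) \<longleftrightarrow> f \<in> Bij L \<and> subfield_endo K L f"
proof -
  interpret K: complex_subfield K by (rule complex_subfield.intro[OF assms(1)])
  interpret L: complex_subfield L by (rule complex_subfield.intro[OF assms(2)])
  have "f \<in> ring_iso (complex_ring\<lparr>carrier := L\<rparr>) (complex_ring\<lparr>carrier := L\<rparr>) \<and> (\<forall>x\<in>K. f x = x) \<longleftrightarrow>
      subfield_endo K L f" if "f \<in> Bij L"
  proof
    assume "f \<in> ring_iso (complex_ring\<lparr>carrier := L\<rparr>) (complex_ring\<lparr>carrier := L\<rparr>) \<and> (\<forall>x\<in>K. f x = x)"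
    then show "subfield_endo K L f"
      by unfold_locales
         (use assms in \<open>auto simp: ring_iso_def Ring.ring_hom_def complex_ring_simps\<close>)
  next
    assume "subfield_endo K L f"
    then interpret subfield_endo K L f .
    show "f \<in> ring_iso (complex_ring\<lparr>carrier := L\<rparr>) (complex_ring\<lparr>carrier := L\<rparr>) \<and> (\<forall>x\<in>K. f x = x)"
      using that by (auto simp: ring_iso_def Ring.ring_hom_def complex_ring_simps Bij_def add mult maps one fix_K)
  qed
  then show ?thesis
    by (auto simp: galois_group_def)
qed

text \<open>Obtained as a subgroup of \<open>BijGroup L\<close>; the group laws are needed for the
  inverse and product cases of the induction over \<open>generate\<close>.\<close>

lemma group_galois_group:
  assumes "subfield K complex_ring" "subfield L complex_ring" "K \<subseteq> L"
  shows "group (galois_group L K)"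
proof -
  note iff = carrier_galois_group_iff[OF assms]
  define H where "H = carrier (galois_group L K)"
  interpret K: complex_subfield K by (rule complex_subfield.intro[OF assms(1)])
  interpret L: complex_subfield L by (rule complex_subfield.intro[OF assms(2)])
  interpret B: group "BijGroup L" by (rule group_BijGroup)
  have "subgroup H (BijGroup L)"
  proof (rule B.subgroupI)
    show "H \<subseteq> carrier (BijGroup L)"
      by (auto simp: H_def iff BijGroup_def)
    have "subfield_endo K L (\<lambda>x\<in>L. x)"
      by unfold_locales (use assms(3) in \<open>auto simp: L.add_mem L.mult_mem\<close>)
    then have "(\<lambda>x\<in>L. x) \<in> H"
      by (simp add: H_def iff id_Bij)
    then show "H \<noteq> {}" by blast
  next
    fix f assume "f \<in> H"
    then have f: "f \<in> Bij L" "subfield_endo K L f"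
      by (auto simp: H_def iff)
    interpret f: subfield_endo K L f by (rule f)
    define g where "g = (\<lambda>x\<in>L. inv_into L f x)"
    have g: "g x \<in> L" "f (g x) = x" if "x \<in> L" for x
      using that f(1) by (auto simp: g_def Bij_def bij_betw_def inv_into_into f_inv_into_f)
    have gf: "g (f x) = x" if "x \<in> L" for x
      using f.inj[of "g (f x)" x] that by (simp add: g f.maps)
    have "subfield_endo K L g"
    proof unfold_locales
      fix x y assume x: "x \<in> L" and y: "y \<in> L"
      show "g (x + y) = g x + g y"
        using gf[of "g x + g y"] x y by (simp add: f.add g L.add_mem)
      show "g (x * y) = g x * g y"
        using gf[of "g x * g y"] x y by (simp add: f.mult g L.mult_mem)
    next
      fix x assume "x \<in> K"
      then show "g x = x"
        using gf[of x] assms(3) by (auto simp: f.fix_K)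
    qed (use assms(3) g in auto)
    then have "g \<in> H"
      using restrict_inv_into_Bij[OF f(1)] by (simp add: H_def iff g_def)
    then show "inv\<^bsub>BijGroup L\<^esub> f \<in> H"
      using f(1) by (simp add: inv_BijGroup g_def)
  next
    fix f g assume "f \<in> H" "g \<in> H"
    then have fg: "f \<in> Bij L" "subfield_endo K L f" "g \<in> Bij L" "subfield_endo K L g"
      by (auto simp: H_def iff)
    interpret f: subfield_endo K L f by (rule fg)
    interpret g: subfield_endo K L g by (rule fg)
    have "subfield_endo K L (compose L f g)"
      by unfold_locales
         (use assms(3) in \<open>auto simp: compose_def L.add_mem L.mult_mem f.maps g.maps f.add g.add
            f.mult g.mult f.fix_K g.fix_K\<close>)
    then show "f \<otimes>\<^bsub>BijGroup L\<^esub> g \<in> H"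
      using fg by (simp add: H_def iff BijGroup_def compose_Bij)
  qed
  then have "group ((BijGroup L)\<lparr>carrier := H\<rparr>)"
    by (rule subgroup.subgroup_is_group) (rule group_BijGroup)
  then show ?thesis
    by (simp add: H_def galois_group_def)
qed

text \<open>The stabilizer of \<open>y\<close> is a subgroup. For a cyclic Galois group this puts
  every element fixed by the generator into the base field.\<close>

lemma generate_galois_group_fixed:
  assumes "subfield K complex_ring" "subfield L complex_ring" "K \<subseteq> L"
    and "\<sigma> \<in> carrier (galois_group L K)" "y \<in> L" "\<sigma> y = y"
    and "g \<in> generate (galois_group L K) {\<sigma>}"
  shows "g y = y"
proof -
  interpret G: group "galois_group L K" by (rule group_galois_group[OF assms(1-3)])
  have mult: "(g \<otimes>\<^bsub>galois_group L K\<^esub> h) z = g (h z)"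
    if "g \<in> carrier (galois_group L K)" "h \<in> carrier (galois_group L K)" "z \<in> L" for g h z
    using that by (simp add: galois_group_def BijGroup_def compose_def)
  have one_apply: "\<one>\<^bsub>galois_group L K\<^esub> z = z" if "z \<in> L" for z
    using that by (simp add: galois_group_def BijGroup_def)
  have \<sigma>: "{\<sigma>} \<subseteq> carrier (galois_group L K)"
    using assms by simp
  from assms(7) show ?thesis
  proof induction
    case one
    then show ?case using assms by (simp add: one_apply)
  next
    case (incl h)
    then show ?case using assms by simp
  next
    case (inv h)
    have "(inv\<^bsub>galois_group L K\<^esub> \<sigma>) (\<sigma> y) =
        (inv\<^bsub>galois_group L K\<^esub> \<sigma> \<otimes>\<^bsub>galois_group L K\<^esub> \<sigma>) y"
      using assms by (intro mult[symmetric] G.inv_closed)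
    also have "\<dots> = y"
      using assms by (simp add: one_apply)
    finally show ?case
      using inv assms by simp
  next
    case (eng h1 h2)
    then show ?case
      using G.generate_in_carrier[OF \<sigma>] assms(5) by (simp add: mult)
  qed
qed

text \<open>The n + 1 iterates of \<sigma> at \<alpha> are roots of one polynomial over
  \<open>K\<close> of degree at most n, so two of them agree. Injectivity cancels the smaller
  exponent, and a power of \<sigma> fixing \<alpha> and \<open>K\<close> fixes all they
  generate.\<close>

lemma primitive_element_endo_order:
  assumes "subfield_endo K L \<sigma>" "ring.dimension complex_ring n K L"
    and L: "L = generate_field complex_ring (insert \<alpha> K)"
  obtains m where "0 < m" "m \<le> n" "\<And>x. x \<in> L \<Longrightarrow> (\<sigma> ^^ m) x = x"
proof -
  interpret \<sigma>: subfield_endo K L \<sigma> by (rule assms)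
  interpret \<sigma>i: subfield_endo K L "\<sigma> ^^ i" for i by (rule \<sigma>.funpow)
  have \<alpha>: "\<alpha> \<in> L"
    unfolding L by (rule generate_field.incl) simp
  obtain P where P: "P \<noteq> 0" "degree P \<le> n" "\<And>i. coeff P i \<in> K" "poly P \<alpha> = 0"
    using dimension_power_relation[OF \<sigma>.K.subfield \<sigma>.L.subfield assms(2) \<alpha>] by blast
  have roots: "(\<lambda>i. (\<sigma> ^^ i) \<alpha>) ` {0..n} \<subseteq> {x. poly P x = 0}"
    using \<sigma>i.poly[OF P(3) \<alpha>] P(4) \<sigma>i.zero by auto
  have "card {x. poly P x = 0} \<le> n"
    using card_poly_roots_bound[OF P(1)] P(2) by simp
  then have "card ((\<lambda>i. (\<sigma> ^^ i) \<alpha>) ` {0..n}) < card {0..n}"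
    using card_mono[OF poly_roots_finite[OF P(1)] roots] by simp
  then have "\<not> inj_on (\<lambda>i. (\<sigma> ^^ i) \<alpha>) {0..n}"
    by (rule pigeonhole)
  then obtain i j where ij: "i < j" "j \<le> n" "(\<sigma> ^^ i) \<alpha> = (\<sigma> ^^ j) \<alpha>"
    unfolding inj_on_def by (metis atLeastAtMost_iff nat_neq_iff)
  define m where "m = j - i"
  have "(\<sigma> ^^ i) ((\<sigma> ^^ m) \<alpha>) = (\<sigma> ^^ i) \<alpha>"
    using ij by (simp add: m_def flip: funpow_add[unfolded o_def, THEN fun_cong])
  then have m: "(\<sigma> ^^ m) \<alpha> = \<alpha>"
    using \<sigma>i.inj \<sigma>i.maps \<alpha> by blast
  \<comment> \<open>Membership in \<open>L\<close> is carried through the induction because the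
    homomorphism laws are available only there.\<close>
  have "x \<in> L \<and> (\<sigma> ^^ m) x = x" if "x \<in> generate_field complex_ring (insert \<alpha> K)" for x
    using that
  proof induction
    case one
    then show ?case
      by (simp add: complex_ring_simps \<sigma>.L.one_mem \<sigma>i.one)
  next
    case (incl h)
    then show ?case
      using \<alpha> m \<sigma>.K_subset \<sigma>i.fix_K by auto
  next
    case (a_inv h)
    then show ?case
      by (simp add: a_inv_complex_ring \<sigma>.L.uminus_mem \<sigma>i.uminus)
  next
    case (m_inv h)
    then have "h \<noteq> 0"
      by (simp add: complex_ring_simps)
    with m_inv show ?case
      using \<sigma>i.divide[of 1 h m]
      by (simp add: m_inv_complex_ring \<sigma>.L.divide_mem \<sigma>.L.one_mem \<sigma>i.one inverse_eq_divide)
  next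
    case (eng_add h1 h2)
    then show ?case
      by (simp add: complex_ring_simps \<sigma>.L.add_mem \<sigma>i.add)
  next
    case (eng_mult h1 h2)
    then show ?case
      by (simp add: complex_ring_simps \<sigma>.L.mult_mem \<sigma>i.mult)
  qed
  then show ?thesis
    using that[of m] ij L by (simp add: m_def)
qed

section \<open>Integral bases\<close>

text \<open>Coefficients have type \<open>rat\<close> rather than being complex numbers in the
  rationals, so that the order, \<open>floor\<close> and \<open>frac\<close> apply to them.\<close>

definition rat_comb :: "(nat \<Rightarrow> complex) \<Rightarrow> nat \<Rightarrow> (nat \<Rightarrow> rat) \<Rightarrow> complex" where
  "rat_comb e k c = (\<Sum>i<k. of_rat (c i) * e i)"

lemma rat_comb_add: "rat_comb e k (\<lambda>i. c i + d i) = rat_comb e k c + rat_comb e k d"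
  by (simp add: rat_comb_def of_rat_add algebra_simps sum.distrib)

lemma rat_comb_diff: "rat_comb e k (\<lambda>i. c i - d i) = rat_comb e k c - rat_comb e k d"
  by (simp add: rat_comb_def of_rat_diff algebra_simps sum_subtractf)

lemma rat_comb_scale: "rat_comb e k (\<lambda>i. q * c i) = of_rat q * rat_comb e k c"
  by (simp add: rat_comb_def of_rat_mult algebra_simps sum_distrib_left)

lemma rat_comb_sum:
  "rat_comb e k (\<lambda>i. \<Sum>j\<in>J. c j i) = (\<Sum>j\<in>J. rat_comb e k (c j))"
  unfolding rat_comb_def of_rat_sum sum_distrib_right by (rule sum.swap)

lemma rat_comb_extend: "k \<le> l \<Longrightarrow> rat_comb e k c = rat_comb e l (\<lambda>i. if i < k then c i else 0)"
  unfolding rat_comb_def by (intro sum.mono_neutral_cong_left) auto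

text \<open>Triangular construction: the \<open>k\<close>-th basis element has the least positive \<open>k\<close>-th coordinate
  among the elements of \<open>G\<close> in the rational span of the first \<open>k + 1\<close> vectors. The finiteness of
  the unit box ensures that this least coordinate exists.\<close>

lemma int_basis_if_finite_unit_box:
  fixes G :: "complex set" and e :: "nat \<Rightarrow> complex"
  assumes zero: "0 \<in> G" and add: "\<And>x y. x \<in> G \<Longrightarrow> y \<in> G \<Longrightarrow> x + y \<in> G"
    and uminus: "\<And>x. x \<in> G \<Longrightarrow> - x \<in> G"
    and e: "\<And>i. i < N \<Longrightarrow> e i \<in> G"
    and span: "\<And>x. x \<in> G \<Longrightarrow> \<exists>c. x = rat_comb e N c"
    and indep: "\<And>c. rat_comb e N c = 0 \<Longrightarrow> \<forall>i<N. c i = 0"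
    and fin: "finite {x \<in> G. \<exists>c. (\<forall>i<N. \<bar>c i\<bar> \<le> 1) \<and> x = rat_comb e N c}"
  shows "\<exists>f :: nat \<Rightarrow> complex. (\<forall>i<N. f i \<in> G) \<and>
    (\<forall>x\<in>G. \<exists>b :: nat \<Rightarrow> int. x = (\<Sum>i<N. of_int (b i) * f i)) \<and>
    (\<forall>b :: nat \<Rightarrow> int. (\<Sum>i<N. of_int (b i) * f i) = 0 \<longrightarrow> (\<forall>i<N. b i = 0))"
proof -
  have scale: "of_int m * x \<in> G" if "x \<in> G" for m :: int and x
  proof -
    have nat: "of_nat n * x \<in> G" for n
      by (induction n) (auto simp: algebra_simps intro: zero add that)
    show ?thesis
    proof (cases m)
      case (nonneg n)
      with nat[of n] show ?thesis by simp
    next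
      case (neg n)
      with uminus[OF nat[of "Suc n"]] show ?thesis
        by (simp del: of_nat_Suc)
    qed
  qed
  have sum: "(\<Sum>i\<in>I. g i) \<in> G" if "\<And>i. i \<in> I \<Longrightarrow> g i \<in> G" for I :: "nat set" and g
    using that by (induction I rule: infinite_finite_induct) (auto intro: zero add)
  have indep': "\<forall>i<k. c i = 0" if "rat_comb e k c = 0" "k \<le> N" for k c
    using indep[of "\<lambda>i. if i < k then c i else 0"] that rat_comb_extend[OF that(2), of e c]
    by (metis order_less_le_trans)
  define Gk where "Gk k = {x \<in> G. \<exists>c. x = rat_comb e k c}" for k
  have "\<exists>f :: nat \<Rightarrow> complex. (\<forall>i<k. f i \<in> Gk k) \<and>
      (\<forall>x\<in>Gk k. \<exists>b :: nat \<Rightarrow> int. x = (\<Sum>i<k. of_int (b i) * f i)) \<and>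
      (\<forall>b :: nat \<Rightarrow> int. (\<Sum>i<k. of_int (b i) * f i) = 0 \<longrightarrow> (\<forall>i<k. b i = 0))" if "k \<le> N" for k
    using that
  proof (induction k)
    case 0
    show ?case
      by (auto simp: Gk_def rat_comb_def)
  next
    case (Suc k)
    then obtain f where f: "\<forall>i<k. f i \<in> Gk k"
        "\<forall>x\<in>Gk k. \<exists>b :: nat \<Rightarrow> int. x = (\<Sum>i<k. of_int (b i) * f i)"
        "\<And>b :: nat \<Rightarrow> int. (\<Sum>i<k. of_int (b i) * f i) = 0 \<Longrightarrow> (\<forall>i<k. b i = 0)"
      by auto
    have "k < N" using Suc by simp
    \<comment> \<open>Candidates for the least positive k-th coordinate. The bound 1 is attained by
      \<open>e k\<close> and makes the set finite.\<close>
    define T where "T = {q. 0 < q \<and> q \<le> 1 \<and> (\<exists>c. c k = q \<and> rat_comb e (Suc k) c \<in> G)}"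
    define box where "box = {x \<in> G. \<exists>c. (\<forall>i<N. \<bar>c i\<bar> \<le> 1) \<and> x = rat_comb e N c}"
    \<comment> \<open>Reads off the k-th coordinate, which is unique by independence; it exhibits
      \<open>T\<close> as part of the image of the finite unit box.\<close>
    define top where "top x = (SOME c. x = rat_comb e N c) k" for x
    have top: "top (rat_comb e N c) = c k" for c
    proof -
      have "rat_comb e N c = rat_comb e N (SOME d. rat_comb e N c = rat_comb e N d)"
        by (rule someI[where P = "\<lambda>d. rat_comb e N c = rat_comb e N d"]) (rule refl)
      then have "rat_comb e N (\<lambda>i. c i - (SOME d. rat_comb e N c = rat_comb e N d) i) = 0"
        by (simp add: rat_comb_diff)
      from indep[OF this] \<open>k < N\<close> show ?thesis
        by (simp add: top_def)
    qed
    have "T \<subseteq> top ` box"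
    proof
      fix q assume "q \<in> T"
      then obtain c where q: "0 < q" "q \<le> 1" and c: "c k = q" "rat_comb e (Suc k) c \<in> G"
        by (auto simp: T_def)
      \<comment> \<open>Removing the integer parts of the lower coordinates stays in
        \<open>G\<close>, keeps the k-th coordinate and lands in the unit box.\<close>
      define d where "d i = (if i < k then frac (c i) else if i = k then q else 0)" for i
      have "rat_comb e (Suc k) c - (\<Sum>i<k. of_int \<lfloor>c i\<rfloor> * e i) = rat_comb e (Suc k) d"
        using c(1) by (simp add: rat_comb_def d_def frac_def of_rat_diff algebra_simps sum_subtractf)
      also have "\<dots> = rat_comb e N (\<lambda>i. if i < Suc k then d i else 0)"
        using \<open>k < N\<close> by (intro rat_comb_extend) simp
      also have "(\<lambda>i. if i < Suc k then d i else 0) = d"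
        by (auto simp: d_def)
      finally have eq: "rat_comb e (Suc k) c + - (\<Sum>i<k. of_int \<lfloor>c i\<rfloor> * e i) = rat_comb e N d"
        by simp
      have "rat_comb e N d \<in> G"
        unfolding eq[symmetric] using \<open>k < N\<close>
        by (intro add c uminus sum scale e) auto
      moreover have "\<bar>d i\<bar> \<le> 1" for i
        using q frac_lt_1[of "c i"] by (auto simp: d_def intro: less_imp_le)
      ultimately have "rat_comb e N d \<in> box"
        by (auto simp: box_def intro!: exI[of _ d])
      moreover have "top (rat_comb e N d) = q"
        by (simp add: top d_def)
      ultimately show "q \<in> top ` box"
        by blast
    qed
    then have "finite T"
      using fin finite_surj by (auto simp: box_def)
    have "rat_comb e (Suc k) (\<lambda>i. if i = k then 1 else 0) = e k"
      by (simp add: rat_comb_def)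
    then have "1 \<in> T"
      using e[OF \<open>k < N\<close>] by (auto simp: T_def intro!: exI[of _ "\<lambda>i. if i = k then 1 else 0"])
    define q where "q = Min T"
    have "q \<in> T"
      using \<open>finite T\<close> \<open>1 \<in> T\<close> unfolding q_def by (intro Min_in) auto
    then obtain c where q: "0 < q" "q \<le> 1" and c: "c k = q" "rat_comb e (Suc k) c \<in> G"
      by (auto simp: T_def)
    define g where "g = rat_comb e (Suc k) c"
    define f' where "f' = f(k := g)"
    have f'_sum: "(\<Sum>i<Suc k. of_int (b i) * f' i) = (\<Sum>i<k. of_int (b i) * f i) + of_int (b k) * g"
      for b :: "nat \<Rightarrow> int"
      by (simp add: f'_def)
    have Gk_mono: "x \<in> Gk (Suc k)" if "x \<in> Gk k" for x
      using that rat_comb_extend[of k "Suc k" e] by (auto simp: Gk_def)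
    have "g \<in> Gk (Suc k)"
      using c by (auto simp: g_def Gk_def)
    then have "\<forall>i<Suc k. f' i \<in> Gk (Suc k)"
      using f(1) Gk_mono by (auto simp: f'_def less_Suc_eq)
    moreover have "\<exists>b :: nat \<Rightarrow> int. x = (\<Sum>i<Suc k. of_int (b i) * f' i)" if x: "x \<in> Gk (Suc k)" for x
    proof -
      obtain d where d: "x = rat_comb e (Suc k) d" "x \<in> G"
        using x by (auto simp: Gk_def)
      \<comment> \<open>Division with remainder: subtracting \<open>m\<close> copies of
        \<open>g\<close> leaves a k-th coordinate in [0, q), which is 0 by minimality of
        \<open>q\<close>, so the induction hypothesis applies to \<open>y\<close>.\<close>
      define m where "m = \<lfloor>d k / q\<rfloor>"
      define y where "y = x + - (of_int m * g)"
      define d' where "d' i = d i - of_int m * c i" for i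
      have "y \<in> G"
        unfolding y_def using d(2) c(2) by (intro add uminus scale) (simp_all add: g_def)
      have y: "y = rat_comb e (Suc k) d'"
        unfolding d'_def by (simp add: rat_comb_diff rat_comb_scale y_def g_def d(1))
      have "of_int m \<le> d k / q" "d k / q < of_int m + 1"
        unfolding m_def by linarith+
      then have d'k: "0 \<le> d' k" "d' k < q"
        using q(1) by (simp_all add: d'_def c(1) field_simps)
      have "d' k = 0"
      proof (rule ccontr)
        assume "d' k \<noteq> 0"
        then have "d' k \<in> T"
          using d'k q y \<open>y \<in> G\<close> by (auto simp: T_def)
        then have "q \<le> d' k"
          unfolding q_def using \<open>finite T\<close> by simp
        with d'k show False by simp
      qed
      then have "y = rat_comb e k d'"
        unfolding y by (simp add: rat_comb_def)
      then have "y \<in> Gk k"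
        using \<open>y \<in> G\<close> by (auto simp: Gk_def)
      then obtain b :: "nat \<Rightarrow> int" where b: "y = (\<Sum>i<k. of_int (b i) * f i)"
        using f(2) by blast
      have "x = (\<Sum>i<Suc k. of_int ((b(k := m)) i) * f' i)"
        unfolding f'_sum using b by (simp add: y_def algebra_simps)
      then show ?thesis by blast
    qed
    moreover have "\<forall>i<Suc k. b i = 0" if b: "(\<Sum>i<Suc k. of_int (b i) * f' i) = 0" for b :: "nat \<Rightarrow> int"
    proof -
      \<comment> \<open>The earlier basis elements have no k-th coordinate, so comparing k-th
        coordinates in the relation forces \<open>b k * q = 0\<close>.\<close>
      have "\<exists>h. \<forall>i<k. f i = rat_comb e k (h i)"
        using f(1) unfolding Gk_def by (intro choice_iff'[THEN iffD1]) auto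
      then obtain h where h: "\<And>i. i < k \<Longrightarrow> f i = rat_comb e k (h i)"
        by blast
      define s where "s j = (\<Sum>i<k. of_int (b i) * h i j)" for j
      have "(\<Sum>i<k. of_int (b i) * f i) = rat_comb e k s"
        unfolding s_def rat_comb_sum rat_comb_scale by (simp add: h)
      also have "\<dots> = rat_comb e (Suc k) (\<lambda>i. if i < k then s i else 0)"
        by (rule rat_comb_extend) simp
      finally have "rat_comb e (Suc k) (\<lambda>i. (if i < k then s i else 0) + of_int (b k) * c i) = 0"
        using b unfolding f'_sum by (simp add: rat_comb_add rat_comb_scale g_def)
      from indep'[OF this Suc.prems] have "of_int (b k) * c k = 0"
        by auto
      then have "b k = 0"
        using c(1) q(1) by simp
      with b have "\<forall>i<k. b i = 0"
        unfolding f'_sum by (intro f(3)) simp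
      with \<open>b k = 0\<close> show ?thesis
        by (simp add: less_Suc_eq)
    qed
    ultimately show ?case by blast
  qed
  from this[of N] show ?thesis
    using span by (auto simp: Gk_def)
qed

section \<open>The ring of integers of \<open>L\<close>\<close>

lemma cmod_of_rat: "cmod (of_rat q) = of_rat \<bar>q\<bar>"
proof -
  obtain a b where "quotient_of q = (a, b)"
    by (cases "quotient_of q")
  then have "q = of_int a / of_int b"
    by (rule quotient_of_div)
  then show ?thesis
    by (simp add: of_rat_divide norm_divide flip: of_int_abs)
qed

locale suitable_data =
  fixes U nt :: nat and K L :: "complex set" and p :: complex and \<sigma> :: "complex \<Rightarrow> complex"
  assumes U_pos: "U > 0" and nt_pos: "nt > 0" and suitable: "suitable U nt K L p \<sigma>"
begin

definition OL :: "complex set" where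
  "OL = {x \<in> L. algebraic_int x}"

lemma fields:
  "imaginary_quadratic K" "subfield \<rat> complex_ring" "subfield K complex_ring"
  "subfield L complex_ring" "K \<subseteq> L" "ring.dimension complex_ring 2 \<rat> K"
  "ring.dimension complex_ring (U * nt) K L"
  using suitable
  by (auto simp: suitable_def imaginary_quadratic_def galois_extension_of_degree_def
      field_extension_of_degree_def)

sublocale K: complex_subfield K
  by (rule complex_subfield.intro[OF fields(3)])

sublocale L: complex_subfield L
  by (rule complex_subfield.intro[OF fields(4)])

lemma \<sigma>_galois: "\<sigma> \<in> carrier (galois_group L K)"
  using suitable by (auto simp: suitable_def)

lemma subfield_endo_\<sigma>: "subfield_endo K L \<sigma>"
  using carrier_galois_group_iff[OF fields(3-5)] \<sigma>_galois by blast

text \<open>All iterates are interpreted at once, so each imported fact has the exponent as a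
  parameter; \<sigma> itself is the exponent 1.\<close>

sublocale \<sigma>: subfield_endo K L "\<sigma> ^^ i" for i
  by (rule subfield_endo.funpow[OF subfield_endo_\<sigma>])

lemma fixed_imp_mem_K:
  assumes "x \<in> L" "\<sigma> x = x"
  shows "x \<in> K"
proof -
  have "g x = x" if "g \<in> carrier (galois_group L K)" for g
    using generate_galois_group_fixed[OF fields(3-5) \<sigma>_galois assms, of g] suitable that
    by (auto simp: suitable_def)
  then have "x \<in> {x \<in> L. \<forall>f \<in> carrier (galois_group L K). f x = x}"
    using assms by blast
  then show ?thesis
    using suitable by (auto simp: suitable_def galois_extension_of_degree_def)
qed

lemma OL_one: "1 \<in> OL"
  and OL_zero: "0 \<in> OL"
  and OL_uminus: "x \<in> OL \<Longrightarrow> - x \<in> OL"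
  and OL_add: "x \<in> OL \<Longrightarrow> y \<in> OL \<Longrightarrow> x + y \<in> OL"
  and OL_diff: "x \<in> OL \<Longrightarrow> y \<in> OL \<Longrightarrow> x - y \<in> OL"
  and OL_mult: "x \<in> OL \<Longrightarrow> y \<in> OL \<Longrightarrow> x * y \<in> OL"
  by (auto simp: OL_def L.one_mem L.zero_mem L.uminus_mem L.add_mem L.diff_mem L.mult_mem
      intro: int_imp_algebraic_int algebraic_int_add_mult algebraic_int_diff)

lemma OL_\<sigma>_iff: "x \<in> L \<Longrightarrow> (\<sigma> ^^ i) x \<in> OL \<longleftrightarrow> x \<in> OL"
  by (simp add: OL_def \<sigma>.maps \<sigma>.algebraic_int_iff)

lemma carrier_OL: "carrier (ring_of_integers L) = OL"
  by (simp add: ring_of_integers_def OL_def)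

lemma norm_ge_1_K:
  assumes "x \<in> K" "algebraic_int x" "x \<noteq> 0"
  shows "cmod x \<ge> 1"
  using imaginary_quadratic_norm_ge_1[OF fields(1) assms] .

text \<open>The relative norm of a nonzero integer of \<open>L\<close> is a nonzero integer of the imaginary quadratic
  field \<open>K\<close>, hence has absolute value at least \<open>1\<close>.\<close>

lemma exists_conjugate_ge_1:
  assumes "x \<in> OL" "x \<noteq> 0"
  shows "\<exists>i<U * nt. cmod ((\<sigma> ^^ i) x) \<ge> 1"
proof (rule ccontr)
  assume "\<not> ?thesis"
  then have less_1: "cmod ((\<sigma> ^^ i) x) < 1" if "i < U * nt" for i
    using that by (auto simp: not_le)
  obtain \<alpha> where "L = generate_field complex_ring (insert \<alpha> K)"
    using suitable by (auto simp: suitable_def)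
  then obtain m where m: "0 < m" "m \<le> U * nt" "\<And>x. x \<in> L \<Longrightarrow> (\<sigma> ^^ m) x = x"
    using primitive_element_endo_order[OF subfield_endo_\<sigma> fields(7)] by blast
  have x: "x \<in> L" "algebraic_int x"
    using assms by (auto simp: OL_def)
  \<comment> \<open>Applying \<sigma> shifts the factors and the last one returns to
    \<open>x\<close>, so \<open>y\<close> is fixed. As \<open>m \<le> U * nt\<close>, all its
    factors are among the conjugates assumed small.\<close>
  define y where "y = (\<Prod>i<m. (\<sigma> ^^ i) x)"
  have "\<sigma> y = (\<Prod>i<m. (\<sigma> ^^ Suc i) x)"
    using \<sigma>.prod[of "{..<m}" "\<lambda>i. (\<sigma> ^^ i) x" 1] x by (simp add: y_def \<sigma>.maps)
  also have "\<dots> = (\<Prod>i<Suc m. (\<sigma> ^^ i) x) / x"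
    using assms(2) by (subst prod.lessThan_Suc_shift) simp
  also have "\<dots> = y"
    using assms(2) m(3)[OF x(1)] by (simp add: y_def)
  finally have "\<sigma> y = y" .
  moreover have "y \<in> L"
    unfolding y_def by (intro L.prod_mem \<sigma>.maps x)
  ultimately have "y \<in> K"
    by (intro fixed_imp_mem_K)
  moreover have "algebraic_int y"
    unfolding y_def using x by (intro algebraic_int_prod) (simp add: \<sigma>.algebraic_int_iff)
  moreover have "y \<noteq> 0"
    using assms(2) x by (simp add: y_def \<sigma>.eq_0_iff)
  ultimately have "cmod y \<ge> 1"
    by (rule norm_ge_1_K)
  \<comment> \<open>The factor for exponent 0 is split off to carry the strict inequality; the
    remaining product is only bounded by 1.\<close>
  have "cmod y = cmod x * (\<Prod>i\<in>{..<m} - {0}. cmod ((\<sigma> ^^ i) x))"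
    using prod.remove[of "{..<m}" 0 "\<lambda>i. cmod ((\<sigma> ^^ i) x)"] m(1)
    by (simp add: y_def prod_norm[symmetric])
  also have "(\<Prod>i\<in>{..<m} - {0}. cmod ((\<sigma> ^^ i) x)) \<le> 1"
    using less_1 m(2) by (intro prod_le_1) (auto intro: less_imp_le)
  then have "cmod x * (\<Prod>i\<in>{..<m} - {0}. cmod ((\<sigma> ^^ i) x)) \<le> cmod x"
    by (simp add: mult_left_le)
  also have "\<dots> < 1"
    using less_1[of 0] U_pos nt_pos by simp
  finally show False
    using \<open>cmod y \<ge> 1\<close> by simp
qed

text \<open>If all conjugates of two integers lie pairwise in the same square of side 1/2, the
  conjugates of the difference all have absolute value below 1, so it is 0. A bounded region meets
  only finitely many such squares.\<close>

lemma finite_bounded_conjugates: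
  "finite {x \<in> OL. \<forall>i<U * nt. cmod ((\<sigma> ^^ i) x) \<le> B}" (is "finite ?S")
proof -
  define h where "h x = (\<lambda>i\<in>{..<U * nt}. (\<lfloor>2 * Re ((\<sigma> ^^ i) x)\<rfloor>, \<lfloor>2 * Im ((\<sigma> ^^ i) x)\<rfloor>))" for x
  define M where "M = \<lfloor>2 * B\<rfloor> + 1"
  have bound: "\<lfloor>2 * r\<rfloor> \<in> {- M..M}" if "\<bar>r\<bar> \<le> B" for r
    using that unfolding M_def by (simp add: floor_le_iff le_floor_iff) linarith
  have "h ` ?S \<subseteq> {..<U * nt} \<rightarrow>\<^sub>E {- M..M} \<times> {- M..M}"
  proof (intro image_subsetI PiE_I)
    fix x i assume x: "x \<in> ?S" and i: "i \<in> {..<U * nt}"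
    then have "cmod ((\<sigma> ^^ i) x) \<le> B" by simp
    then have "\<bar>Re ((\<sigma> ^^ i) x)\<bar> \<le> B" "\<bar>Im ((\<sigma> ^^ i) x)\<bar> \<le> B"
      using abs_Re_le_cmod abs_Im_le_cmod order_trans by blast+
    with i show "h x i \<in> {- M..M} \<times> {- M..M}"
      using bound unfolding h_def by simp
  qed (simp add: h_def)
  moreover have "finite ({..<U * nt} \<rightarrow>\<^sub>E {- M..M} \<times> {- M..M})"
    by (intro finite_PiE) auto
  ultimately have "finite (h ` ?S)"
    by (rule finite_subset)
  moreover have "inj_on h ?S"
  proof (rule inj_onI, rule ccontr)
    fix x y assume xy: "x \<in> ?S" "y \<in> ?S" "h x = h y" "x \<noteq> y"
    then obtain i where i: "i < U * nt" "cmod ((\<sigma> ^^ i) (x - y)) \<ge> 1"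
      using exists_conjugate_ge_1[of "x - y"] by (auto intro: OL_diff)
    define a b where "a = (\<sigma> ^^ i) x" and "b = (\<sigma> ^^ i) y"
    have "x \<in> L" "y \<in> L" using xy by (auto simp: OL_def)
    then have ab: "cmod (a - b) \<ge> 1"
      using i by (simp add: a_def b_def \<sigma>.diff)
    have "h x i = h y i" using xy by simp
    then have "\<lfloor>2 * Re a\<rfloor> = \<lfloor>2 * Re b\<rfloor>" "\<lfloor>2 * Im a\<rfloor> = \<lfloor>2 * Im b\<rfloor>"
      using i by (auto simp: h_def a_def b_def)
    then have "\<bar>Re (a - b)\<bar> < 1 / 2" "\<bar>Im (a - b)\<bar> < 1 / 2"
      unfolding minus_complex.sel by linarith+
    then show False
      using cmod_le[of "a - b"] ab by linarith
  qed
  ultimately show ?thesis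
    by (rule finite_imageD)
qed

section \<open>The inert prime and its valuation\<close>

text \<open>For \<open>cmod_p\<close>: if \<open>p\<close> had absolute value 1, its inverse would
  be \<open>cnj p\<close>, again an algebraic integer, and the ideal of \<open>p\<close> would be
  the whole ring, whereas a prime ideal is proper.\<close>

lemma p_props: "p \<in> K" "algebraic_int p" "p \<noteq> 0" "p \<in> OL"
  and cmod_p: "cmod p > 1"
proof -
  have p: "p \<in> K" "algebraic_int p" "p \<noteq> 0"
    and pr: "primeideal (PIdl\<^bsub>ring_of_integers K\<^esub> p) (ring_of_integers K)"
    using suitable by (auto simp: suitable_def inert_def ring_of_integers_def)
  then show "p \<in> K" "algebraic_int p" "p \<noteq> 0" "p \<in> OL"
    using fields(5) by (auto simp: OL_def)
  show "cmod p > 1"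
  proof (rule ccontr)
    assume "\<not> cmod p > 1"
    then have "cmod p = 1"
      using norm_ge_1_K[OF p] by simp
    then have "p * cnj p = 1"
      by (simp flip: complex_norm_square)
    then have inv: "inverse p = cnj p"
      using p(3) by (simp add: field_simps)
    have "algebraic_int (cnj p)"
      using p(2) by simp
    then have inv: "inverse p \<in> K" "algebraic_int (inverse p)"
      using K.inverse_mem[OF p(1)] unfolding inv by auto
    have "x \<in> PIdl\<^bsub>ring_of_integers K\<^esub> p" if "x \<in> carrier (ring_of_integers K)" for x
    proof -
      have "x * inverse p \<in> carrier (ring_of_integers K)"
        using that inv by (auto simp: ring_of_integers_def K.mult_mem intro: algebraic_int_add_mult)
      moreover have "x = x * inverse p \<otimes>\<^bsub>ring_of_integers K\<^esub> p"
        using p(3) by (simp add: ring_of_integers_def complex_ring_simps)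
      ultimately show ?thesis
        unfolding cgenideal_def by blast
    qed
    moreover have "PIdl\<^bsub>ring_of_integers K\<^esub> p \<subseteq> carrier (ring_of_integers K)"
      using p by (auto simp: cgenideal_def ring_of_integers_def complex_ring_simps K.mult_mem
          intro: algebraic_int_add_mult)
    ultimately show False
      using primeideal.I_notcarr[OF pr] by blast
  qed
qed

text \<open>Primality is inertness. For separation, if all \<open>x / p ^ m\<close> were integers of
  \<open>L\<close>, their conjugates would all tend to 0, since \<sigma> fixes \<open>p\<close> and
  \<open>cmod p > 1\<close>; this contradicts the conjugate of absolute value at least 1.\<close>

sublocale ring_with_prime OL p
proof
  show "1 \<in> OL" "p \<in> OL" "p \<noteq> 0"
    by (rule OL_one p_props)+
  show "x + y \<in> OL" "x * y \<in> OL" if "x \<in> OL" "y \<in> OL" for x y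
    using that by (rule OL_add OL_mult)+
  show "- x \<in> OL" if "x \<in> OL" for x
    using that by (rule OL_uminus)
  show "x / p \<in> OL \<or> y / p \<in> OL" if xy: "x \<in> OL" "y \<in> OL" "x * y / p \<in> OL" for x y
  proof -
    have pr: "primeideal (PIdl\<^bsub>ring_of_integers L\<^esub> p) (ring_of_integers L)"
      using suitable by (auto simp: suitable_def inert_def)
    have mem: "z \<in> PIdl\<^bsub>ring_of_integers L\<^esub> p \<longleftrightarrow> z / p \<in> OL" for z
      using p_props(3) unfolding cgenideal_def carrier_OL
      by (force simp: ring_of_integers_def complex_ring_simps)
    have "x \<otimes>\<^bsub>ring_of_integers L\<^esub> y = x * y"
      by (simp add: ring_of_integers_def complex_ring_simps)
    then show ?thesis
      using primeideal.I_prime[OF pr, of x y] xy by (simp add: mem carrier_OL)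
  qed
  show "\<exists>m. x / p ^ m \<notin> OL" if x: "x \<in> OL" "x \<noteq> 0" for x
  proof (rule ccontr)
    assume "\<not> ?thesis"
    then have all: "x / p ^ m \<in> OL" for m by blast
    define B where "B = Max ((\<lambda>i. cmod ((\<sigma> ^^ i) x)) ` {..<U * nt})"
    have B: "cmod ((\<sigma> ^^ i) x) \<le> B" if "i < U * nt" for i
      unfolding B_def using that by (intro Max_ge) auto
    obtain m where m: "B < cmod p ^ m"
      using real_arch_pow[OF cmod_p] by blast
    obtain i where i: "i < U * nt" "cmod ((\<sigma> ^^ i) (x / p ^ m)) \<ge> 1"
      using exists_conjugate_ge_1[OF all[of m]] x p_props(3) by auto
    have "(\<sigma> ^^ i) (x / p ^ m) = (\<sigma> ^^ i) x / p ^ m"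
      using x p_props fields(5)
      by (subst \<sigma>.divide) (auto simp: OL_def \<sigma>.fix_K K.power_mem)
    then have "cmod ((\<sigma> ^^ i) x) / cmod p ^ m \<ge> 1"
      using i by (simp add: norm_divide norm_power)
    moreover have "cmod p ^ m > 0"
      using p_props(3) by simp
    ultimately have "cmod ((\<sigma> ^^ i) x) \<ge> cmod p ^ m"
      by (simp add: le_divide_eq)
    with B[OF i(1)] m show False by simp
  qed
qed

text \<open>Both sides are the \<open>LEAST\<close> of the same predicate, since \<sigma> fixes
  \<open>p\<close> and preserves integrality in both directions.\<close>

lemma val_\<sigma>:
  assumes "x \<in> L"
  shows "val ((\<sigma> ^^ i) x) = val x"
proof -
  have "(\<sigma> ^^ i) x / p ^ m \<in> OL \<longleftrightarrow> x / p ^ m \<in> OL" for m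
  proof -
    have pm: "p ^ m \<in> K" "p ^ m \<in> L"
      using p_props fields(5) by (auto intro: K.power_mem)
    then have "(\<sigma> ^^ i) x / p ^ m = (\<sigma> ^^ i) (x / p ^ m)"
      using assms by (simp add: \<sigma>.divide \<sigma>.fix_K)
    then show ?thesis
      using OL_\<sigma>_iff[of "x / p ^ m" i] assms pm by (simp add: L.divide_mem)
  qed
  then show ?thesis
    by (simp only: val_def)
qed

text \<open>A rational basis of \<open>L\<close> is scaled into \<open>OL\<close>. By the triangle
  inequality its unit box has bounded conjugates, hence contains finitely many integers, and the
  triangular construction applies.\<close>

lemma integral_basis:
  "\<exists>f :: nat \<Rightarrow> complex. (\<forall>i<2 * (U * nt). f i \<in> OL) \<and>
    (\<forall>x\<in>OL. \<exists>b :: nat \<Rightarrow> int. x = (\<Sum>i<2 * (U * nt). of_int (b i) * f i)) \<and>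
    (\<forall>b :: nat \<Rightarrow> int. (\<Sum>i<2 * (U * nt). of_int (b i) * f i) = 0 \<longrightarrow> (\<forall>i<2 * (U * nt). b i = 0))"
proof -
  define N where "N = 2 * (U * nt)"
  have dim: "ring.dimension complex_ring N \<rat> L"
    unfolding N_def by (rule ring.telescopic_base[OF ring_complex_ring fields(2,3,6,7)])
  obtain e0 where e0: "\<And>x. x \<in> L \<Longrightarrow> \<exists>c. (\<forall>i<N. c i \<in> \<rat>) \<and> x = (\<Sum>i<N. c i * e0 i)"
      "\<And>i. i < N \<Longrightarrow> e0 i \<in> L"
      "\<And>c. (\<And>i. i < N \<Longrightarrow> c i \<in> \<rat>) \<Longrightarrow> (\<Sum>i<N. c i * e0 i) = 0 \<Longrightarrow> \<forall>i<N. c i = 0"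
    using dimension_obtain_basis[OF fields(2) dim] by blast
  have "\<exists>d :: int. d \<noteq> 0 \<and> algebraic_int (of_int d * e0 i)" if "i < N" for i
    using algebraic_obtain_int_multiple algebraic_if_finite_dimension[OF fields(2,4) dim e0(2)[OF that]]
    by metis
  then obtain d :: "nat \<Rightarrow> int" where d: "\<And>i. i < N \<Longrightarrow> d i \<noteq> 0 \<and> algebraic_int (of_int (d i) * e0 i)"
    by metis
  define e where "e i = of_int (d i) * e0 i" for i
  have e: "e i \<in> OL" if "i < N" for i
    using d[OF that] e0(2)[OF that] by (simp add: e_def OL_def L.mult_mem L.of_int_mem)
  have span: "\<exists>c. x = rat_comb e N c" if "x \<in> OL" for x
  proof -
    obtain c where c: "\<forall>i<N. c i \<in> \<rat>" "x = (\<Sum>i<N. c i * e0 i)"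
      using e0(1) \<open>x \<in> OL\<close> by (auto simp: OL_def)
    have "\<forall>i<N. \<exists>q. c i = of_rat q"
      using c(1) by (auto simp: Rats_def)
    then obtain q where "\<And>i. i < N \<Longrightarrow> c i = of_rat (q i)"
      by metis
    then have "x = rat_comb e N (\<lambda>i. q i / of_int (d i))"
      unfolding c(2) rat_comb_def e_def using d
      by (intro sum.cong) (auto simp: of_rat_divide)
    then show ?thesis by blast
  qed
  have indep: "\<forall>i<N. c i = 0" if "rat_comb e N c = 0" for c
  proof -
    have "(\<Sum>i<N. of_rat (c i) * of_int (d i) * e0 i) = 0"
      using that by (simp add: rat_comb_def e_def mult.assoc)
    then have "\<forall>i<N. of_rat (c i) * of_int (d i) = (0 :: complex)"
      by (intro e0(3)) auto
    then show ?thesis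
      using d by auto
  qed
  define B where "B = Max ((\<lambda>j. \<Sum>i<N. cmod ((\<sigma> ^^ j) (e i))) ` {..<U * nt})"
  have "{x \<in> OL. \<exists>c. (\<forall>i<N. \<bar>c i\<bar> \<le> 1) \<and> x = rat_comb e N c}
      \<subseteq> {x \<in> OL. \<forall>i<U * nt. cmod ((\<sigma> ^^ i) x) \<le> B}"
  proof safe
    fix c :: "nat \<Rightarrow> rat" and j
    assume c: "\<forall>i<N. \<bar>c i\<bar> \<le> 1" and j: "j < U * nt"
    have eL: "e i \<in> L" if "i < N" for i
      using e[OF that] by (simp add: OL_def)
    have q: "of_rat q \<in> L" "(\<sigma> ^^ j) (of_rat q) = of_rat q" for q
      using L.Rats_subset by (auto intro: \<sigma>.fix_Rats)
    have "(\<sigma> ^^ j) (rat_comb e N c) = (\<Sum>i<N. of_rat (c i) * (\<sigma> ^^ j) (e i))"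
      unfolding rat_comb_def using eL
      by (subst \<sigma>.sum) (auto simp: q eL L.mult_mem \<sigma>.mult intro!: sum.cong)
    also have "cmod \<dots> \<le> (\<Sum>i<N. cmod (of_rat (c i) * (\<sigma> ^^ j) (e i)))"
      by (rule norm_sum)
    also have "\<dots> \<le> (\<Sum>i<N. cmod ((\<sigma> ^^ j) (e i)))"
    proof (rule sum_mono)
      fix i assume "i \<in> {..<N}"
      have "cmod (of_rat (c i)) \<le> 1"
        using c \<open>i \<in> {..<N}\<close> by (simp add: cmod_of_rat)
      then show "cmod (of_rat (c i) * (\<sigma> ^^ j) (e i)) \<le> cmod ((\<sigma> ^^ j) (e i))"
        by (simp add: norm_mult mult_left_le_one_le)
    qed
    also have "\<dots> \<le> B"
      unfolding B_def using j by (intro Max_ge) auto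
    finally show "cmod ((\<sigma> ^^ j) (rat_comb e N c)) \<le> B" .
  qed
  then have fin: "finite {x \<in> OL. \<exists>c. (\<forall>i<N. \<bar>c i\<bar> \<le> 1) \<and> x = rat_comb e N c}"
    using finite_bounded_conjugates by (rule finite_subset)
  show ?thesis
    using int_basis_if_finite_unit_box[OF OL_zero OL_add OL_uminus e span indep fin]
    unfolding N_def by simp
qed

end

section \<open>The user lattices\<close>

lemma cyclic_index_eq:
  fixes a b n :: nat
  assumes "a < n" "b < n"
  shows "(a + n - b) mod n = (if b \<le> a then a - b else a + n - b)"
proof (cases "b \<le> a")
  case True
  then have "a + n - b = (a - b) + n" by simp
  with True assms show ?thesis by (simp only: mod_add_self2) simp
next
  case False
  with assms show ?thesis by simp
qed

text \<open>Modulo n, a - b = s and b = a - s are equivalent; adding \<open>n\<close> keeps the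
  natural subtraction from truncating.\<close>

lemma cyclic_index_eq_iff:
  fixes a b s n :: nat
  assumes "a < n" "b < n" "s < n"
  shows "(a + n - b) mod n = s \<longleftrightarrow> b = (a + n - s) mod n"
  unfolding cyclic_index_eq[OF assms(1,2)] cyclic_index_eq[OF assms(1,3)] using assms by auto

lemma cyclic_index_inj:
  fixes a a' s n :: nat
  assumes "(a + n - s) mod n = (a' + n - s) mod n" "a < n" "a' < n" "s < n"
  shows "a = a'"
  using assms(1) unfolding cyclic_index_eq[OF assms(2,4)] cyclic_index_eq[OF assms(3,4)]
  using assms(2-4) by (auto split: if_splits)

section \<open>Truncated lattices and the minimum defining \<open>decay\<close>\<close>

lemma int_combination_cong:
  "(\<And>m. m < r \<Longrightarrow> b m = b' m) \<Longrightarrow> int_combination nr nc r B b = int_combination nr nc r B b'"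
  unfolding int_combination_def by (intro cong_mat) auto

lemma int_basis_imp_truncated_subset:
  assumes "int_basis nr nc r B \<Lambda>"
  shows "truncated_lattice nr nc r B n \<subseteq> \<Lambda>"
proof
  have image: "int_combination nr nc r B ` ({..<r} \<rightarrow>\<^sub>E UNIV) = \<Lambda>"
    using assms by (simp add: int_basis_def bij_betw_def)
  fix A assume "A \<in> truncated_lattice nr nc r B n"
  then obtain b where "A = int_combination nr nc r B b"
    by (auto simp: truncated_lattice_def)
  \<comment> \<open>\<open>int_basis\<close> speaks of extensional coefficient functions,
    \<open>truncated_lattice\<close> of arbitrary ones.\<close>
  also have "\<dots> = int_combination nr nc r B (restrict b {..<r})"
    by (rule int_combination_cong) simp
  also have "\<dots> \<in> \<Lambda>"
    unfolding image[symmetric] by (rule imageI) auto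
  finally show "A \<in> \<Lambda>" .
qed

lemma finite_truncated_lattice: "finite (truncated_lattice nr nc r B n)"
proof -
  have "truncated_lattice nr nc r B n \<subseteq>
      int_combination nr nc r B ` ({..<r} \<rightarrow>\<^sub>E {- int n..int n})"
  proof
    fix A assume "A \<in> truncated_lattice nr nc r B n"
    then obtain b where b: "A = int_combination nr nc r B b" "\<forall>m<r. - int n \<le> b m \<and> b m \<le> int n"
      by (auto simp: truncated_lattice_def)
    have "int_combination nr nc r B b = int_combination nr nc r B (restrict b {..<r})"
      by (rule int_combination_cong) simp
    moreover have "restrict b {..<r} \<in> {..<r} \<rightarrow>\<^sub>E {- int n..int n}"
      using b(2) by auto
    ultimately show "A \<in> int_combination nr nc r B ` ({..<r} \<rightarrow>\<^sub>E {- int n..int n})"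
      unfolding b(1) by (rule image_eqI)
  qed
  then show ?thesis
    by (rule finite_subset) (intro finite_imageI finite_PiE, auto)
qed

text \<open>The coefficient vectors (1, 0, ..., 0) and 0 have different images by
  injectivity.\<close>

lemma truncated_lattice_nontrivial:
  assumes "int_basis nr nc r B \<Lambda>" "r > 0" "n > 0"
  shows "truncated_lattice nr nc r B n - {0\<^sub>m nr nc} \<noteq> {}"
proof -
  define b :: "nat \<Rightarrow> int" where "b = (\<lambda>m\<in>{..<r}. if m = 0 then 1 else 0)"
  define z :: "nat \<Rightarrow> int" where "z = (\<lambda>m\<in>{..<r}. 0)"
  have "b 0 \<noteq> z 0"
    using assms(2) by (simp add: b_def z_def)
  then have "b \<noteq> z" by auto
  moreover have "b \<in> {..<r} \<rightarrow>\<^sub>E UNIV" "z \<in> {..<r} \<rightarrow>\<^sub>E UNIV"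
    by (auto simp: b_def z_def)
  ultimately have "int_combination nr nc r B b \<noteq> int_combination nr nc r B z"
    using assms(1) unfolding int_basis_def bij_betw_def inj_on_def by blast
  moreover have "int_combination nr nc r B z = 0\<^sub>m nr nc"
    by (intro eq_matI) (auto simp: int_combination_def z_def)
  moreover have "int_combination nr nc r B b \<in> truncated_lattice nr nc r B n"
    using assms(3) by (auto simp: truncated_lattice_def b_def intro!: exI[of _ b])
  ultimately show ?thesis by auto
qed

lemma finite_stacked_code:
  assumes "nt > 0" "\<And>j. j < U \<Longrightarrow> finite (C j)"
  shows "finite (stacked_code U nt C)"
proof -
  have "stacked_code U nt C \<subseteq> stack U nt ` (\<Pi>\<^sub>E j\<in>{..<U}. C j)"
  proof
    fix A assume "A \<in> stacked_code U nt C"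
    then obtain Z where Z: "A = stack U nt Z" "\<forall>j<U. Z j \<in> C j"
      by (auto simp: stacked_code_def)
    have "A = stack U nt (restrict Z {..<U})"
      unfolding Z(1) stack_def using assms(1)
      by (intro cong_mat) (auto simp: less_mult_imp_div_less)
    then show "A \<in> stack U nt ` (\<Pi>\<^sub>E j\<in>{..<U}. C j)"
      using Z(2) by (intro image_eqI[of _ _ "restrict Z {..<U}"]) auto
  qed
  then show ?thesis
    by (rule finite_subset) (intro finite_imageI finite_PiE, use assms in auto)
qed

text \<open>The set under \<open>Min\<close> is finite and nonempty, so the minimum is attained at a
  stacked matrix. Its row blocks are nonzero elements of the user lattices, hence codewords.\<close>

lemma generalized_rank_criterionI:
  assumes "U > 0" "nt > 0"
    and det: "\<And>A. A \<in> stacked_code U nt C \<Longrightarrow> det A \<noteq> 0"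
  shows "generalized_rank_criterion U nt C"
  unfolding generalized_rank_criterion_def
proof (intro allI impI)
  fix B :: "nat \<Rightarrow> nat \<Rightarrow> complex mat" and N :: "nat \<Rightarrow> nat"
  assume BN: "(\<forall>j<U. int_basis nt (U * nt) (2 * U * nt\<^sup>2) (B j) (user_lattice U nt C j)) \<and> (\<forall>j<U. N j > 0)"
  define T where "T j = truncated_lattice nt (U * nt) (2 * U * nt\<^sup>2) (B j) (N j) - {0\<^sub>m nt (U * nt)}" for j
  have T: "finite (T j)" "T j \<noteq> {}" "T j \<subseteq> C j" if "j < U" for j
  proof -
    have basis: "int_basis nt (U * nt) (2 * U * nt\<^sup>2) (B j) (user_lattice U nt C j)" and "N j > 0"
      using BN that by auto
    show "finite (T j)"
      by (simp add: T_def finite_truncated_lattice)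
    show "T j \<noteq> {}"
      unfolding T_def using assms \<open>N j > 0\<close> by (intro truncated_lattice_nontrivial[OF basis]) auto
    show "T j \<subseteq> C j"
      using int_basis_imp_truncated_subset[OF basis] by (auto simp: T_def user_lattice_def)
  qed
  have "finite (stacked_code U nt T)"
    using assms(2) T(1) by (rule finite_stacked_code)
  moreover have "stacked_code U nt T \<noteq> {}"
  proof -
    have "\<forall>j<U. (SOME A. A \<in> T j) \<in> T j"
      using T(2) by (simp add: some_in_eq)
    then have "stack U nt (\<lambda>j. SOME A. A \<in> T j) \<in> stacked_code U nt T"
      unfolding stacked_code_def by blast
    then show ?thesis by blast
  qed
  ultimately have "decay U nt B N \<in> (\<lambda>A. cmod (det A)) ` stacked_code U nt T"
    unfolding decay_def T_def by (intro Min_in) auto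
  moreover have "stacked_code U nt T \<subseteq> stacked_code U nt C"
    using T(3) by (force simp: stacked_code_def)
  ultimately show "decay U nt B N \<noteq> 0"
    using det by auto
qed

context suitable_data
begin

section \<open>Entries of a code matrix as scaled conjugates of coordinates\<close>

definition scaling :: "int \<Rightarrow> nat \<Rightarrow> nat \<Rightarrow> nat \<Rightarrow> complex" where
  "scaling k j i c = (if c div nt = j then p powi (- k) else 1) * (if c mod nt \<le> i then 1 else p)"

text \<open>Block l contributes \<sigma>^l and column b within it \<tau>^b = \<sigma>^(U b). In this
  mixed radix form each exponent below U nt belongs to exactly one column.\<close>

definition conj_index :: "nat \<Rightarrow> nat" where
  "conj_index c = c div nt + U * (c mod nt)"

definition coord_index :: "nat \<Rightarrow> nat \<Rightarrow> nat" where
  "coord_index i c = (i + nt - c mod nt) mod nt"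

definition int_vec :: "(nat \<Rightarrow> complex) \<Rightarrow> bool" where
  "int_vec x \<longleftrightarrow> (\<forall>h<nt. x h \<in> OL)"

abbreviation code_matrix :: "int \<Rightarrow> nat \<Rightarrow> (nat \<Rightarrow> complex) \<Rightarrow> complex mat" where
  "code_matrix \<equiv> user_matrix U nt p \<sigma>"

lemma coord_index_less: "coord_index i c < nt"
  using nt_pos by (simp add: coord_index_def)

lemma dim_code_matrix [simp]:
  "dim_row (code_matrix k j x) = nt" "dim_col (code_matrix k j x) = U * nt"
  "code_matrix k j x \<in> carrier_mat nt (U * nt)"
  by (simp_all add: user_matrix_def)

text \<open>Merges the two cases of \<open>cyclic_matrix\<close>; the factor \<open>p\<close> leaves
  the automorphism because \<sigma> fixes it.\<close>

lemma code_matrix_entry: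
  assumes "int_vec x" "i < nt" "c < U * nt"
  shows "code_matrix k j x $$ (i, c) = scaling k j i c * (\<sigma> ^^ conj_index c) (x (coord_index i c))"
proof -
  define b where "b = c mod nt"
  define l where "l = c div nt"
  have b: "b < nt" using nt_pos by (simp add: b_def)
  have h: "coord_index i c = (if b \<le> i then i - b else i + nt - b)"
    using cyclic_index_eq[OF assms(2) b] by (simp add: coord_index_def b_def[symmetric])
  have x: "x (coord_index i c) \<in> L"
    using assms(1) coord_index_less by (auto simp: int_vec_def OL_def)
  have pow: "(\<sigma> ^^ l) (((\<sigma> ^^ U) ^^ b) y) = (\<sigma> ^^ conj_index c) y" for y
    by (simp add: conj_index_def l_def b_def funpow_mult funpow_add)
  have "(\<sigma> ^^ l) (cyclic_matrix nt p (\<sigma> ^^ U) x $$ (i, b)) =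
      (if b \<le> i then 1 else p) * (\<sigma> ^^ conj_index c) (x (coord_index i c))"
  proof (cases "b \<le> i")
    case True
    then show ?thesis
      using b assms(2) h by (simp add: cyclic_matrix_def pow)
  next
    case False
    have "p \<in> L" "((\<sigma> ^^ U) ^^ b) (x (coord_index i c)) \<in> L"
      using p_props fields(5) x by (auto simp: funpow_mult \<sigma>.maps)
    with False show ?thesis
      using b assms(2) h p_props by (simp add: cyclic_matrix_def \<sigma>.mult \<sigma>.fix_K pow)
  qed
  moreover have "dim_row (cyclic_matrix nt p (\<sigma> ^^ U) x) = nt" "dim_col (cyclic_matrix nt p (\<sigma> ^^ U) x) = nt"
    by (simp_all add: cyclic_matrix_def)
  ultimately show ?thesis
    using assms(2,3) b by (simp add: user_matrix_def Let_def scaling_def l_def[symmetric] b_def[symmetric])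
qed

lemma user_lattice_eq:
  "user_lattice U nt (user_code U nt L p \<sigma> k) j = {code_matrix k j x | x. int_vec x}"
proof -
  have "code_matrix k j x = 0\<^sub>m nt (U * nt)" if "\<forall>h<nt. x h = 0" for x
  proof -
    have "int_vec x"
      using that by (simp add: int_vec_def OL_zero)
    then show ?thesis
      using that coord_index_less \<sigma>.zero by (intro eq_matI) (simp_all add: code_matrix_entry)
  qed
  note zero = this
  show ?thesis
  proof (intro equalityI subsetI)
    fix A assume "A \<in> user_lattice U nt (user_code U nt L p \<sigma> k) j"
    then consider "A \<in> user_code U nt L p \<sigma> k j" | "A = code_matrix k j (\<lambda>_. 0)"
      using zero[of "\<lambda>_. 0"] by (auto simp: user_lattice_def)
    then show "A \<in> {code_matrix k j x | x. int_vec x}"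
    proof cases
      case 1
      then show ?thesis
        by (auto simp: user_code_def carrier_OL int_vec_def)
    next
      case 2
      moreover have "int_vec (\<lambda>_. 0)"
        by (simp add: int_vec_def OL_zero)
      ultimately show ?thesis by blast
    qed
  next
    fix A assume "A \<in> {code_matrix k j x | x. int_vec x}"
    then obtain x where x: "A = code_matrix k j x" "int_vec x" by blast
    show "A \<in> user_lattice U nt (user_code U nt L p \<sigma> k) j"
    proof (cases "\<exists>h<nt. x h \<noteq> 0")
      case True
      with x have "A \<in> user_code U nt L p \<sigma> k j"
        unfolding user_code_def carrier_OL int_vec_def by blast
      then show ?thesis by (simp add: user_lattice_def)
    next
      case False
      then have "A = 0\<^sub>m nt (U * nt)"
        unfolding x(1) by (intro zero) blast
      then show ?thesis by (simp add: user_lattice_def)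
    qed
  qed
qed

lemma code_matrix_diff:
  assumes "int_vec x" "int_vec y" "i < nt" "c < U * nt"
  shows "code_matrix k j x $$ (i, c) - code_matrix k j y $$ (i, c) =
    code_matrix k j (\<lambda>h. x h - y h) $$ (i, c)"
proof -
  have "int_vec (\<lambda>h. x h - y h)"
    using assms(1,2) by (simp add: int_vec_def OL_diff)
  moreover have "x (coord_index i c) \<in> L" "y (coord_index i c) \<in> L"
    using assms(1,2) coord_index_less by (auto simp: int_vec_def OL_def)
  ultimately show ?thesis
    using assms by (simp add: code_matrix_entry \<sigma>.diff right_diff_distrib)
qed

lemma code_matrix_sum:
  assumes "\<And>m. m < r \<Longrightarrow> int_vec (x m)"
  shows "int_combination nt (U * nt) r (\<lambda>m. code_matrix k j (x m)) b =
    code_matrix k j (\<lambda>h. \<Sum>m<r. of_int (b m) * x m h)" (is "?A = ?B")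
proof (rule eq_matI)
  have bL: "of_int (b m) \<in> OL" for m
    using L.of_int_mem by (auto simp: OL_def intro: int_imp_algebraic_int)
  fix i c assume "i < dim_row ?B" "c < dim_col ?B"
  then have ic: "i < nt" "c < U * nt" by simp_all
  define h where "h = coord_index i c"
  have vec: "int_vec (\<lambda>h. \<Sum>m<r. of_int (b m) * x m h)"
    using assms bL by (auto simp: int_vec_def intro!: sum_mem mult_mem)
  have xL: "x m h \<in> L" if "m < r" for m
    using assms[OF that] coord_index_less by (auto simp: int_vec_def OL_def h_def)
  have "?A $$ (i, c) = (\<Sum>m<r. of_int (b m) * (scaling k j i c * (\<sigma> ^^ conj_index c) (x m h)))"
    using ic assms by (simp add: int_combination_def code_matrix_entry h_def)
  also have "\<dots> = scaling k j i c * (\<Sum>m<r. (\<sigma> ^^ conj_index c) (of_int (b m) * x m h))"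
    unfolding sum_distrib_left
  proof (intro sum.cong refl)
    fix m assume "m \<in> {..<r}"
    then show "of_int (b m) * (scaling k j i c * (\<sigma> ^^ conj_index c) (x m h)) =
        scaling k j i c * (\<sigma> ^^ conj_index c) (of_int (b m) * x m h)"
      using xL by (simp add: \<sigma>.mult L.of_int_mem \<sigma>.fix_K K.of_int_mem)
  qed
  also have "\<dots> = scaling k j i c * (\<sigma> ^^ conj_index c) (\<Sum>m<r. of_int (b m) * x m h)"
    using xL by (subst \<sigma>.sum) (auto intro: L.mult_mem L.of_int_mem)
  also have "\<dots> = ?B $$ (i, c)"
    using ic vec by (simp add: code_matrix_entry h_def)
  finally show "?A $$ (i, c) = ?B $$ (i, c)" .
qed (simp_all add: int_combination_def)

text \<open>Writing t = l + U b determines the column, and the row is then h + b modulo nt. Thus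
  every conjugate of every coordinate is visible in the matrix.\<close>

lemma exists_entry:
  assumes "t < U * nt" "h < nt"
  obtains i c where "i < nt" "c < U * nt" "conj_index c = t" "coord_index i c = h"
proof -
  define b l where "b = t div U" and "l = t mod U"
  have b: "b < nt"
    unfolding b_def using assms(1) by (simp add: less_mult_imp_div_less mult.commute)
  have l: "l < U" using U_pos by (simp add: l_def)
  define c where "c = l * nt + b"
  have "l * nt + b < Suc l * nt" using b by simp
  also have "\<dots> \<le> U * nt" using l by (intro mult_le_mono1) simp
  finally have c: "c < U * nt" by (simp add: c_def)
  have cd: "c div nt = l" "c mod nt = b"
    using b by (simp_all add: c_def)
  define i where "i = (h + b) mod nt"
  have i: "i < nt" using nt_pos by (simp add: i_def)
  have "(i + nt - b) mod nt = h"
    using assms(2) b by (cases "h + b < nt") (auto simp: i_def mod_if Nat.add_diff_assoc2)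
  then show ?thesis
    using that[of i c] i c by (simp add: conj_index_def coord_index_def cd) (simp add: l_def b_def)
qed

text \<open>As \<open>cmod p > 1\<close> and \<open>k \<ge> 0\<close>, every scaling factor has
  absolute value at least \<open>cmod p powi (- k)\<close>, and a nonzero coordinate has a conjugate
  of absolute value at least 1. Applied to differences, this gives both injectivity of the encoding
  and discreteness.\<close>

lemma code_matrix_small_imp_zero:
  assumes "int_vec x" "k \<ge> 0" "h < nt"
    and small: "\<And>i c. i < nt \<Longrightarrow> c < U * nt \<Longrightarrow> cmod (code_matrix k j x $$ (i, c)) < cmod p powi (- k)"
  shows "x h = 0"
proof (rule ccontr)
  assume "x h \<noteq> 0"
  moreover have "x h \<in> OL"
    using assms by (simp add: int_vec_def)
  ultimately obtain t where t: "t < U * nt" "cmod ((\<sigma> ^^ t) (x h)) \<ge> 1"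
    using exists_conjugate_ge_1 by blast
  obtain i c where ic: "i < nt" "c < U * nt" "conj_index c = t" "coord_index i c = h"
    using exists_entry[OF t(1) assms(3)] .
  have le1: "cmod p powi (- k) \<le> 1"
    using power_int_increasing[of "- k" 0 "cmod p"] assms(2) cmod_p by simp
  have pos: "cmod p powi (- k) \<ge> 0"
    by simp
  have "cmod p powi (- k) * 1 \<le> cmod (if c div nt = j then p powi (- k) else 1) * cmod (if c mod nt \<le> i then 1 else p)"
    using le1 cmod_p pos by (intro mult_mono) (auto simp: norm_power_int)
  then have "cmod p powi (- k) \<le> cmod (scaling k j i c)"
    by (simp add: scaling_def norm_mult)
  then have "cmod p powi (- k) * 1 \<le> cmod (scaling k j i c) * cmod ((\<sigma> ^^ t) (x h))"
    using t(2) pos by (intro mult_mono) auto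
  also have "\<dots> = cmod (code_matrix k j x $$ (i, c))"
    using ic assms(1) by (simp add: code_matrix_entry norm_mult)
  finally show False
    using small[OF ic(1,2)] by simp
qed

lemma code_matrix_inj:
  assumes "int_vec x" "int_vec y" "code_matrix k j x = code_matrix k j y" "k \<ge> 0" "h < nt"
  shows "x h = y h"
proof -
  have vec: "int_vec (\<lambda>h. x h - y h)"
    using assms by (simp add: int_vec_def OL_diff)
  have "code_matrix k j (\<lambda>h. x h - y h) $$ (i, c) = 0" if "i < nt" "c < U * nt" for i c
    using code_matrix_diff[OF assms(1,2) that, of k j] assms(3) by simp
  then have "x h - y h = 0"
    using p_props(3) by (intro code_matrix_small_imp_zero[OF vec assms(4,5), of j]) simp
  then show ?thesis by simp
qed

lemma discrete_user_lattice:
  assumes "k \<ge> 0"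
  shows "discrete_matrices nt (U * nt) {code_matrix k j x | x. int_vec x}"
  unfolding discrete_matrices_def
proof (intro ballI exI conjI impI)
  show "cmod p powi (- k) > 0"
    using p_props(3) by simp
  fix A B assume "A \<in> {code_matrix k j x | x. int_vec x}" "B \<in> {code_matrix k j x | x. int_vec x}"
  then obtain x y where x: "A = code_matrix k j x" "int_vec x" and y: "B = code_matrix k j y" "int_vec y"
    by blast
  assume small: "\<forall>i<nt. \<forall>c<U * nt. cmod (A $$ (i, c) - B $$ (i, c)) < cmod p powi (- k)"
  have vec: "int_vec (\<lambda>h. x h - y h)"
    using x y by (simp add: int_vec_def OL_diff)
  have eq: "x h = y h" if "h < nt" for h
  proof -
    have "x h - y h = 0"
      using small x y by (intro code_matrix_small_imp_zero[OF vec assms that, of j])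
        (simp add: code_matrix_diff[symmetric])
    then show ?thesis by simp
  qed
  show "B = A"
    unfolding x(1) y(1)
    by (intro eq_matI) (use x y eq coord_index_less in \<open>simp_all add: code_matrix_entry\<close>)
qed

lemma additive_subgroup_user_lattice:
  "additive_subgroup {code_matrix k j x | x. int_vec x} (module_mat TYPE(complex) nt (U * nt))"
  (is "additive_subgroup ?S ?M")
proof (rule additive_subgroupI)
  interpret M: abelian_group ?M by (rule abelian_group_mat)
  have diff: "A - B \<in> ?S" if "A \<in> ?S" "B \<in> ?S" for A B
  proof -
    obtain x y where x: "A = code_matrix k j x" "int_vec x" and y: "B = code_matrix k j y" "int_vec y"
      using \<open>A \<in> ?S\<close> \<open>B \<in> ?S\<close> by blast
    have "A - B = code_matrix k j (\<lambda>h. x h - y h)"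
      using x y by (intro eq_matI) (simp_all add: code_matrix_diff)
    moreover have "int_vec (\<lambda>h. x h - y h)"
      using x y by (simp add: int_vec_def OL_diff)
    ultimately show ?thesis by blast
  qed
  have carrier: "A \<in> carrier_mat nt (U * nt)" if "A \<in> ?S" for A
    using that by auto
  have "int_vec (\<lambda>_. 0)"
    by (simp add: int_vec_def OL_zero)
  then have ne: "code_matrix k j (\<lambda>_. 0) \<in> ?S" by blast
  have zero: "0\<^sub>m nt (U * nt) \<in> ?S"
    using diff[OF ne ne] carrier[OF ne] by simp
  have uminus: "- A \<in> ?S" if "A \<in> ?S" for A
  proof -
    have "0\<^sub>m nt (U * nt) - A = - A"
      using carrier[OF that] by (intro eq_matI) auto
    then show ?thesis
      using diff[OF zero that] by simp
  qed
  show "subgroup ?S (add_monoid ?M)"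
  proof (rule M.add.subgroupI)
    show "?S \<subseteq> carrier ?M"
      using carrier by (auto simp: module_mat_simps)
    show "?S \<noteq> {}" using zero by blast
    show "\<ominus>\<^bsub>?M\<^esub> A \<in> ?S" if "A \<in> ?S" for A
    proof -
      have "- A \<oplus>\<^bsub>?M\<^esub> A = \<zero>\<^bsub>?M\<^esub>"
        using carrier[OF that] by (simp add: module_mat_simps)
      then have "\<ominus>\<^bsub>?M\<^esub> A = - A"
        using carrier[OF that] by (intro M.minus_equality) (auto simp: module_mat_simps)
      then show ?thesis using uminus[OF that] by simp
    qed
    show "A \<oplus>\<^bsub>?M\<^esub> B \<in> ?S" if "A \<in> ?S" "B \<in> ?S" for A B
    proof -
      have "A + B = A - (- B)"
        using carrier[OF that(1)] carrier[OF that(2)] by (intro eq_matI) auto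
      then show ?thesis
        using diff[OF that(1) uminus[OF that(2)]] by (simp add: module_mat_simps)
    qed
  qed
qed

text \<open>The vectors with one integral basis element in one coordinate form a basis of the
  integer vectors, of rank nt times 2 U nt. The encoding is additive and injective, so it transports
  this basis; \<open>m\<close> encodes the pair of coordinate \<open>m div N\<close> and basis index
  \<open>m mod N\<close>.\<close>

lemma int_basis_user_lattice:
  assumes "k \<ge> 0"
  shows "\<exists>B. int_basis nt (U * nt) (2 * U * nt\<^sup>2) B {code_matrix k j x | x. int_vec x}"
proof -
  define N where "N = 2 * (U * nt)"
  define r where "r = 2 * U * nt\<^sup>2"
  have r: "r = nt * N"
    by (simp add: r_def N_def power2_eq_square)
  have N: "N > 0"
    using U_pos nt_pos by (simp add: N_def)
  obtain f :: "nat \<Rightarrow> complex" where f: "\<forall>i<N. f i \<in> OL"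
      "\<forall>x\<in>OL. \<exists>b :: nat \<Rightarrow> int. x = (\<Sum>i<N. of_int (b i) * f i)"
      "\<forall>b :: nat \<Rightarrow> int. (\<Sum>i<N. of_int (b i) * f i) = 0 \<longrightarrow> (\<forall>i<N. b i = 0)"
    using integral_basis unfolding N_def by blast
  define g where "g m h = (if h = m div N then f (m mod N) else 0)" for m h
  define B where "B m = code_matrix k j (g m)" for m
  have g: "int_vec (g m)" for m
    using f(1) N by (simp add: g_def int_vec_def OL_zero)
  have block_less: "h * N + i < r" if "h < nt" "i < N" for h i
  proof -
    have "h * N + i < Suc h * N" using that by simp
    also have "\<dots> \<le> nt * N" using that by (intro mult_le_mono1) simp
    finally show ?thesis by (simp add: r)
  qed
  have block: "(\<Sum>m<r. of_int (b m) * g m h) = (\<Sum>i<N. of_int (b (h * N + i)) * f i)"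
    if "h < nt" for b :: "nat \<Rightarrow> int" and h
  proof -
    have "(\<Sum>i<N. of_int (b (h * N + i)) * f i) =
        (\<Sum>m\<in>(\<lambda>i. h * N + i) ` {..<N}. of_int (b m) * g m h)"
      by (subst sum.reindex) (auto simp: inj_on_def g_def intro!: sum.cong)
    also have "\<dots> = (\<Sum>m<r. of_int (b m) * g m h)"
    proof (rule sum.mono_neutral_left)
      show "(\<lambda>i. h * N + i) ` {..<N} \<subseteq> {..<r}"
        using block_less[OF that] by auto
      show "\<forall>m\<in>{..<r} - (\<lambda>i. h * N + i) ` {..<N}. of_int (b m) * g m h = 0"
      proof
        fix m assume m: "m \<in> {..<r} - (\<lambda>i. h * N + i) ` {..<N}"
        have "h \<noteq> m div N"
        proof
          assume "h = m div N"
          then have "m = h * N + m mod N" by simp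
          moreover have "m mod N \<in> {..<N}" using N by simp
          ultimately show False using m by blast
        qed
        then show "of_int (b m) * g m h = 0" by (simp add: g_def)
      qed
    qed simp
    finally show ?thesis by simp
  qed
  have comb: "int_combination nt (U * nt) r B b = code_matrix k j (\<lambda>h. \<Sum>m<r. of_int (b m) * g m h)"
    for b :: "nat \<Rightarrow> int"
    unfolding B_def by (rule code_matrix_sum[OF g])
  have vec: "int_vec (\<lambda>h. \<Sum>m<r. of_int (b m) * g m h)" for b :: "nat \<Rightarrow> int"
  proof -
    have "of_int (b m) \<in> OL" for m
      using L.of_int_mem by (auto simp: OL_def intro: int_imp_algebraic_int)
    then show ?thesis
      using g by (auto simp: int_vec_def intro!: sum_mem mult_mem)
  qed
  have "bij_betw (int_combination nt (U * nt) r B) ({..<r} \<rightarrow>\<^sub>E UNIV) {code_matrix k j x | x. int_vec x}"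
  proof (rule bij_betw_imageI)
    show "inj_on (int_combination nt (U * nt) r B) ({..<r} \<rightarrow>\<^sub>E UNIV)"
    proof (rule inj_onI)
      fix b b' :: "nat \<Rightarrow> int"
      assume ext: "b \<in> {..<r} \<rightarrow>\<^sub>E UNIV" "b' \<in> {..<r} \<rightarrow>\<^sub>E UNIV"
        and eq: "int_combination nt (U * nt) r B b = int_combination nt (U * nt) r B b'"
      show "b = b'"
      proof (rule PiE_ext[OF ext])
        fix m assume "m \<in> {..<r}"
        define h i where "h = m div N" and "i = m mod N"
        have h: "h < nt"
          using \<open>m \<in> {..<r}\<close> by (simp add: h_def r less_mult_imp_div_less)
        have "(\<Sum>i<N. of_int (b (h * N + i)) * f i) = (\<Sum>i<N. of_int (b' (h * N + i)) * f i)"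
          using code_matrix_inj[OF vec vec eq[unfolded comb] assms h] by (simp add: block[OF h])
        then have "(\<Sum>i<N. of_int (b (h * N + i) - b' (h * N + i)) * f i) = 0"
          by (simp add: algebra_simps sum_subtractf)
        then have "\<forall>i<N. b (h * N + i) - b' (h * N + i) = 0"
          using f(3)[rule_format, of "\<lambda>i. b (h * N + i) - b' (h * N + i)"] by blast
        moreover have "i < N" "m = h * N + i"
          using N by (simp_all add: h_def i_def)
        ultimately show "b m = b' m" by auto
      qed
    qed
    show "int_combination nt (U * nt) r B ` ({..<r} \<rightarrow>\<^sub>E UNIV) = {code_matrix k j x | x. int_vec x}"
    proof (intro equalityI subsetI)
      fix A assume "A \<in> int_combination nt (U * nt) r B ` ({..<r} \<rightarrow>\<^sub>E UNIV)"
      then show "A \<in> {code_matrix k j x | x. int_vec x}"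
        using comb vec by blast
    next
      fix A assume "A \<in> {code_matrix k j x | x. int_vec x}"
      then obtain x where x: "A = code_matrix k j x" "int_vec x" by blast
      have "\<forall>h<nt. \<exists>b :: nat \<Rightarrow> int. x h = (\<Sum>i<N. of_int (b i) * f i)"
        using x(2) f(2) by (simp add: int_vec_def)
      then obtain b :: "nat \<Rightarrow> nat \<Rightarrow> int"
        where b: "\<And>h. h < nt \<Longrightarrow> x h = (\<Sum>i<N. of_int (b h i) * f i)"
        by metis
      define b' where "b' = (\<lambda>m\<in>{..<r}. b (m div N) (m mod N))"
      have b'x: "(\<Sum>m<r. of_int (b' m) * g m h) = x h" if "h < nt" for h
        unfolding block[OF that] b[OF that]
        by (intro sum.cong) (auto simp: b'_def block_less[OF that])
      have "A = int_combination nt (U * nt) r B b'"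
        unfolding x(1) comb
        by (intro eq_matI) (use x(2) vec[of b'] b'x coord_index_less in \<open>simp_all add: code_matrix_entry\<close>)
      moreover have "b' \<in> {..<r} \<rightarrow>\<^sub>E UNIV"
        by (simp add: b'_def)
      ultimately show "A \<in> int_combination nt (U * nt) r B ` ({..<r} \<rightarrow>\<^sub>E UNIV)"
        by blast
    qed
  qed
  moreover have "\<forall>m<r. B m \<in> {code_matrix k j x | x. int_vec x}"
    using g by (auto simp: B_def)
  ultimately show ?thesis
    unfolding int_basis_def r_def by blast
qed

lemma full_rate_user_code:
  assumes "k \<ge> 0"
  shows "full_rate U nt (user_code U nt L p \<sigma> k)"
  unfolding full_rate_def matrix_lattice_def user_lattice_eq
  using additive_subgroup_user_lattice discrete_user_lattice[OF assms] int_basis_user_lattice[OF assms]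
  by blast

end

section \<open>The rank criterion\<close>

context suitable_data
begin

lemma det_stacked_code_nonzero:
  assumes "k > 0" and A: "A \<in> stacked_code U nt (user_code U nt L p \<sigma> k)"
  shows "det A \<noteq> 0"
proof -
  define n where "n = U * nt"
  obtain Z where Z: "A = stack U nt Z" "\<forall>j<U. Z j \<in> user_code U nt L p \<sigma> k j"
    using A by (auto simp: stacked_code_def)
  have "\<forall>j<U. \<exists>x. Z j = code_matrix k j x \<and> int_vec x \<and> (\<exists>h<nt. x h \<noteq> 0)"
    using Z(2) unfolding user_code_def carrier_OL int_vec_def by blast
  then obtain x where x: "\<And>j. j < U \<Longrightarrow> Z j = code_matrix k j (x j)" "\<And>j. j < U \<Longrightarrow> int_vec (x j)"
      "\<And>j. j < U \<Longrightarrow> \<exists>h<nt. x j h \<noteq> 0"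
    by metis
  have xOL: "x j h \<in> OL" if "j < U" "h < nt" for j h
    using x(2)[OF that(1)] that(2) by (simp add: int_vec_def)
  have idx: "r div nt < U" "r mod nt < nt" if "r < n" for r
    using that nt_pos by (auto simp: n_def less_mult_imp_div_less)
  define A' where "A' = p ^ nat k \<cdot>\<^sub>m A"
  \<comment> \<open>The exponent of \<open>p\<close> left once the denominator is cleared: the power
    k has moved from the diagonal blocks to all the others.\<close>
  define off where "off r c = (if c div nt = r div nt then 0 else nat k) + (if c mod nt \<le> r mod nt then 0 else 1)" for r c
  have A'_carrier: "A' \<in> carrier_mat n n"
    by (simp add: A'_def Z(1) stack_def n_def)
  have entry: "A' $$ (r, c) = p ^ off r c * (\<sigma> ^^ conj_index c) (x (r div nt) (coord_index (r mod nt) c))"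
    if "r < n" "c < n" for r c
  proof -
    have "p ^ nat k * p powi (- k) = 1"
      using assms(1) p_nonzero by (simp add: power_int_minus flip: power_int_of_nat)
    then have "p ^ nat k * scaling k (r div nt) (r mod nt) c = p ^ off r c"
      by (auto simp: scaling_def off_def mult.assoc[symmetric])
    moreover have "A' $$ (r, c) = p ^ nat k * code_matrix k (r div nt) (x (r div nt)) $$ (r mod nt, c)"
      using that x(1)[OF idx(1)[OF that(1)]] by (simp add: A'_def Z(1) stack_def n_def)
    ultimately show ?thesis
      using that x(2)[OF idx(1)[OF that(1)]] idx(2)[OF that(1)]
      by (simp add: code_matrix_entry n_def mult.assoc[symmetric])
  qed

  define weight where "weight j h = nt * val (x j h) + h" for j h
  have "\<exists>s<nt. x j s \<noteq> 0 \<and> (\<forall>h<nt. x j h \<noteq> 0 \<longrightarrow> weight j s \<le> weight j h)" if "j < U" for j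
    using ex_has_least_nat[of "\<lambda>h. h < nt \<and> x j h \<noteq> 0" _ "weight j"] x(3)[OF that] by blast
  then obtain s where s: "\<And>j. j < U \<Longrightarrow> s j < nt" "\<And>j. j < U \<Longrightarrow> x j (s j) \<noteq> 0"
      "\<And>j h. j < U \<Longrightarrow> h < nt \<Longrightarrow> x j h \<noteq> 0 \<Longrightarrow> weight j (s j) \<le> weight j h"
    by metis
  have s_strict: "weight j (s j) < weight j h" if "j < U" "h < nt" "x j h \<noteq> 0" "h \<noteq> s j" for j h
  proof -
    have "weight j h mod nt = h" "weight j (s j) mod nt = s j"
      using that s(1) by (simp_all add: weight_def)
    then have "weight j h \<noteq> weight j (s j)"
      using that by metis
    with s(3)[OF that(1-3)] show ?thesis by simp
  qed
  \<comment> \<open>The corrections -a and -b are shifted by the constant nt - 1 to stay in the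
    natural numbers; the shift is the same on both sides of every comparison.\<close>
  define \<alpha> where "\<alpha> r = weight (r div nt) (s (r div nt)) + (nt - 1 - r mod nt)" for r
  define \<beta> where "\<beta> c = nt - 1 - c mod nt" for c
  \<comment> \<open>In each row, \<pi> selects the column of the diagonal block where the minimising
    coordinate of that user stands. Outside the index range it is the identity, as
    \<open>permutes\<close> demands.\<close>
  define \<pi> where "\<pi> r = (if r < n then (r div nt) * nt + (r mod nt + nt - s (r div nt)) mod nt else r)" for r

  have nonzero: "x (r div nt) (coord_index (r mod nt) c) \<noteq> 0" if "r < n" "c < n" "A' $$ (r, c) \<noteq> 0" for r c
    using that by (auto simp: entry \<sigma>.zero)
  have val_entry: "nt * val (A' $$ (r, c)) + \<beta> c =
      nt * (if c div nt = r div nt then 0 else nat k) +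
      weight (r div nt) (coord_index (r mod nt) c) + (nt - 1 - r mod nt)"
    if rc: "r < n" "c < n" and nz: "x (r div nt) (coord_index (r mod nt) c) \<noteq> 0" for r c
  proof -
    define h where "h = coord_index (r mod nt) c"
    define y where "y = x (r div nt) h"
    have y: "y \<in> OL" "y \<noteq> 0"
      using xOL idx(1)[OF rc(1)] coord_index_less nz by (auto simp: y_def h_def)
    then have yL: "y \<in> L" by (simp add: OL_def)
    have "val (A' $$ (r, c)) = val (p ^ off r c * (\<sigma> ^^ conj_index c) y)"
      by (simp add: entry rc y_def h_def)
    also have "\<dots> = off r c + val y"
      using y yL p_nonzero
      by (subst val_mult) (auto simp: power_p_mem val_power_p val_\<sigma> OL_\<sigma>_iff \<sigma>.eq_0_iff)
    finally have val: "val (A' $$ (r, c)) = off r c + val y" .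
    \<comment> \<open>Above the diagonal of a block the index h wraps around by nt, and precisely
      there the entry carries a factor \<open>p\<close>, worth nt in weight. The two cancel, so the
      weight depends on h and not on the position.\<close>
    define e where "e = (if c mod nt \<le> r mod nt then 0 else nt)"
    have lt: "r mod nt < nt" "c mod nt < nt"
      using nt_pos by auto
    then have h: "h + c mod nt = r mod nt + e"
      unfolding h_def coord_index_def e_def by (simp add: cyclic_index_eq)
    have off: "nt * off r c = nt * (if c div nt = r div nt then 0 else nat k) + e"
      by (simp add: off_def e_def)
    have "r mod nt + (nt - 1 - r mod nt) = nt - 1" "c mod nt + (nt - 1 - c mod nt) = nt - 1"
      using lt by linarith+
    with h off show ?thesis
      unfolding val weight_def h_def[symmetric] y_def[symmetric] \<beta>_def distrib_left by linarith
  qed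
  have \<pi>_div_mod: "\<pi> r < n" "\<pi> r div nt = r div nt" "\<pi> r mod nt = (r mod nt + nt - s (r div nt)) mod nt"
    if "r < n" for r
  proof -
    define b where "b = (r mod nt + nt - s (r div nt)) mod nt"
    have b: "b < nt" using nt_pos by (simp add: b_def)
    have \<pi>: "\<pi> r = (r div nt) * nt + b"
      using that by (simp add: \<pi>_def b_def)
    have "\<dots> < Suc (r div nt) * nt" using b by simp
    also have "\<dots> \<le> n"
      unfolding n_def using idx(1)[OF that] by (intro mult_le_mono1) simp
    finally show "\<pi> r < n" by (simp add: \<pi>)
    show "\<pi> r div nt = r div nt" "\<pi> r mod nt = (r mod nt + nt - s (r div nt)) mod nt"
      using b by (simp_all add: \<pi> b_def[symmetric])
  qed
  have coord_\<pi>: "coord_index (r mod nt) c = s (r div nt) \<longleftrightarrow> c mod nt = (r mod nt + nt - s (r div nt)) mod nt"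
    if "r < n" for r c
    unfolding coord_index_def using idx[OF that] s(1) nt_pos by (intro cyclic_index_eq_iff) auto
  have eq_\<pi>: "c = \<pi> r" if "r < n" "c div nt = r div nt" "coord_index (r mod nt) c = s (r div nt)" for r c
    using that \<pi>_div_mod[OF that(1)] coord_\<pi>[OF that(1), of c] by (metis div_mult_mod_eq)

  have "inj_on \<pi> {0..<n}"
  proof (rule inj_onI)
    fix r r' assume r: "r \<in> {0..<n}" "r' \<in> {0..<n}" "\<pi> r = \<pi> r'"
    then have rn: "r < n" "r' < n" by auto
    have div: "r div nt = r' div nt"
      using \<pi>_div_mod(2)[OF rn(1)] \<pi>_div_mod(2)[OF rn(2)] r(3) by simp
    have mod: "(r mod nt + nt - s (r div nt)) mod nt = (r' mod nt + nt - s (r div nt)) mod nt"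
      using \<pi>_div_mod(3)[OF rn(1)] \<pi>_div_mod(3)[OF rn(2)] r(3) div by simp
    have "r mod nt = r' mod nt"
      using cyclic_index_inj[OF mod idx(2)[OF rn(1)] idx(2)[OF rn(2)] s(1)[OF idx(1)[OF rn(1)]]] .
    with div show "r = r'"
      by (metis div_mult_mod_eq)
  qed
  moreover have "\<pi> ` {0..<n} \<subseteq> {0..<n}"
    using \<pi>_div_mod(1) by auto
  ultimately have "bij_betw \<pi> {0..<n} {0..<n}"
    by (simp add: bij_betw_def endo_inj_surj)
  then have "\<pi> permutes {0..<n}"
    by (rule bij_imp_permutes) (simp add: \<pi>_def)

  moreover have "A' $$ (r, c) \<in> OL" if "r < n" "c < n" for r c
  proof -
    have "x (r div nt) (coord_index (r mod nt) c) \<in> OL"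
      using xOL idx(1)[OF that(1)] coord_index_less by blast
    moreover from this have "x (r div nt) (coord_index (r mod nt) c) \<in> L"
      by (simp add: OL_def)
    ultimately show ?thesis
      using that by (auto simp: entry OL_\<sigma>_iff intro!: mult_mem power_p_mem)
  qed
  moreover have "A' $$ (r, \<pi> r) \<noteq> 0 \<and> nt * val (A' $$ (r, \<pi> r)) + \<beta> (\<pi> r) = \<alpha> r" if "r < n" for r
  proof -
    have coord: "coord_index (r mod nt) (\<pi> r) = s (r div nt)"
      using coord_\<pi> \<pi>_div_mod(3) that by blast
    then have nz: "x (r div nt) (coord_index (r mod nt) (\<pi> r)) \<noteq> 0"
      using s(2)[OF idx(1)[OF that]] by simp
    moreover have "x (r div nt) (coord_index (r mod nt) (\<pi> r)) \<in> L"
      using xOL idx(1)[OF that] coord_index_less by (auto simp: OL_def)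
    ultimately have "A' $$ (r, \<pi> r) \<noteq> 0"
      using that \<pi>_div_mod(1) p_nonzero by (simp add: entry \<sigma>.eq_0_iff)
    then show ?thesis
      using val_entry[OF that \<pi>_div_mod(1)[OF that] nz] \<pi>_div_mod(2)[OF that] coord
      by (simp add: \<alpha>_def)
  qed
  moreover have "\<alpha> r < nt * val (A' $$ (r, c)) + \<beta> c"
    if "r < n" "c < n" "A' $$ (r, c) \<noteq> 0" "c \<noteq> \<pi> r" for r c
  proof -
    note nz = nonzero[OF that(1-3)]
    have le: "weight (r div nt) (s (r div nt)) \<le> weight (r div nt) (coord_index (r mod nt) c)"
      using s(3)[OF idx(1)[OF that(1)] coord_index_less nz] .
    show ?thesis
    proof (cases "c div nt = r div nt")
      case True
      then have "coord_index (r mod nt) c \<noteq> s (r div nt)"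
        using eq_\<pi> that by blast
      then have "weight (r div nt) (s (r div nt)) < weight (r div nt) (coord_index (r mod nt) c)"
        using s_strict[OF idx(1)[OF that(1)] coord_index_less nz] by simp
      then show ?thesis
        unfolding val_entry[OF that(1,2) nz] \<alpha>_def by simp
    next
      case False
      \<comment> \<open>Off the diagonal blocks the coordinate may itself be the minimising one, so
        strictness comes from the additional power of \<open>p\<close>.\<close>
      have "nt * nat k > 0"
        using nt_pos assms(1) by simp
      with le have "\<alpha> r < nt * nat k + weight (r div nt) (coord_index (r mod nt) c) + (nt - 1 - r mod nt)"
        unfolding \<alpha>_def by linarith
      then show ?thesis
        unfolding val_entry[OF that(1,2) nz] using False by simp
    qed
  qed
  ultimately have "det A' \<noteq> 0"
    using det_nonzero_if_dominant_permutation[OF A'_carrier nt_pos, of \<pi> \<beta> \<alpha>] by blast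
  then show ?thesis
    by (auto simp: A'_def)
qed

end

theorem theorem4p5:
  fixes U nt :: nat and C :: "nat \<Rightarrow> complex mat set"
  assumes "U > 0" and "nt > 0" and "C \<in> code_family U nt"
  shows "full_rate U nt C \<and> generalized_rank_criterion U nt C"
proof -
  obtain K L p \<sigma> k where C: "C = user_code U nt L p \<sigma> k" and suitable: "suitable U nt K L p \<sigma>"
    and k: "of_int k > real U * (real nt - 1) / 2"
    using assms(3) by (auto simp: code_family_def)
  interpret suitable_data U nt K L p \<sigma>
    by unfold_locales (use assms suitable in auto)
  \<comment> \<open>The lower bound on k is nonnegative because nt is at least 1, which makes k
    positive.\<close>
  have "real U * (real nt - 1) / 2 \<ge> 0"
    using assms(2) by simp
  with k have "k > 0"
    by linarith
  then show ?thesis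
    unfolding C using full_rate_user_code det_stacked_code_nonzero
    by (intro conjI generalized_rank_criterionI assms) auto
qed

end
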